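(* Let $K$ be a Cantor set. For every $z\in K$, the group $$\mathrm{Homeo}(K)_{[z]}=\{g\in\mathrm{Homeo}(K) : g \text{ fixes a neighborhood of } z \text{ pointwise}\}$$ is binate. In particular, $\mathrm{Homeo}(K)_{[z]}$ is boundedly acyclic.
   Context: A Cantor set is a metric space which is compact, totally disconnected and perfect (has no isolated points). $\mathrm{Homeo}(K)$ is the group of all homeomorphisms $K\to K$. A group $\Gamma$ is binate if for every finitely generated subgroup $H\le\Gamma$ there exist a homomorphism $\phi:H\to\Gamma$ and an element $\gamma\in\Gamma$ such that $h=[\gamma,\phi(h)]=\gamma^{-1}\phi(h)^{-1}\gamma\phi(h)$ for all $h\in H$. A group $\Gamma$ (always discrete) is boundedly acyclic if $H_b^n(\Gamma;\mathbb{R})=0$ for all $n\ge1$. Here $C_b^n(\Gamma;\mathbb{R})$ is the space of bounded functions $f:\Gamma^{n+1}\to\mathbb{R}$, with $\Gamma$-action $(g\cdot f)(g_0,\dots,g_n)=f(g^{-1}g_0,\dots,g^{-1}g_n)$ and coboundary $\delta^n f(g_0,\dots,g_{n+1})=\sum_{i=0}^{n+1}(-1)^i f(g_0,\dots,\widehat{g_i},\dots,g_{n+1})$, and $H_b^n(\Gamma;\mathbb{R})$ is the $n$-th cohomology of the complex $(C_b^\bullet(\Gamma;\mathbb{R})^\Gamma,\delta^\bullet)$. *)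

theory Defs
  imports
    "HOL-Analysis.Analysis"
    "HOL-Algebra.Bij"
    "HOL-Algebra.Generated_Groups"
    "HOL-Algebra.Elementary_Groups"
begin

section \<open>Cantor sets and groups of homeomorphisms\<close>

definition totally_disconnected :: "'a::topological_space set \<Rightarrow> bool"
  where "totally_disconnected S \<longleftrightarrow> (\<forall>C\<in>components S. \<exists>x. C = {x})"

text \<open>The metric space is the set \<open>K\<close> with the metric of the ambient type.
  The empty set is not excluded.\<close>

definition cantor_set :: "'a::metric_space set \<Rightarrow> bool"
  where "cantor_set K \<longleftrightarrow>
    compact K \<and> totally_disconnected K \<and> (\<forall>x\<in>K. x islimpt K)"

text \<open>As in \<^const>\<open>BijGroup\<close>, the self-maps of \<open>K\<close> are represented by functions that are
  \<^const>\<open>undefined\<close> outside \<open>K\<close>, and the product of \<open>g\<close> and \<open>f\<close> is \<open>g \<circ> f\<close>.\<close>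

definition homeo_group :: "'a::topological_space set \<Rightarrow> ('a \<Rightarrow> 'a) monoid"
  where "homeo_group K =
    (BijGroup K)\<lparr>carrier := {f \<in> Bij K. \<exists>g. homeomorphism K K f g}\<rparr>"

definition homeo_germ_stabilizer :: "'a::topological_space set \<Rightarrow> 'a \<Rightarrow> ('a \<Rightarrow> 'a) monoid"
  where "homeo_germ_stabilizer K z =
    (homeo_group K)\<lparr>carrier := {g \<in> carrier (homeo_group K).
       \<exists>U. openin (top_of_set K) U \<and> z \<in> U \<and> (\<forall>x\<in>U. g x = x)}\<rparr>"

lemma subgroup_homeo_group:
  "subgroup {f \<in> Bij K. \<exists>g. homeomorphism K K f g} (BijGroup K)"
proof -
  interpret group "BijGroup K" by (rule group_BijGroup)
  show ?thesis
  proof (rule subgroupI)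
    have "homeomorphism K K (\<lambda>x\<in>K. x) id"
      by (rule homeomorphism_cong[OF homeomorphism_ident[of K]]) auto
    then show "{f \<in> Bij K. \<exists>g. homeomorphism K K f g} \<noteq> {}"
      using id_Bij by blast
  next
    fix f assume "f \<in> {f \<in> Bij K. \<exists>g. homeomorphism K K f g}"
    then obtain g where f: "f \<in> Bij K" and h: "homeomorphism K K f g" by blast
    have "inv_into K f x = g x" if "x \<in> K" for x
      using that h f by (metis Bij_def IntD2 bij_betw_def homeomorphism_def image_eqI inv_into_f_eq mem_Collect_eq)
    then have "homeomorphism K K (\<lambda>x\<in>K. inv_into K f x) f"
      by (intro homeomorphism_cong[OF homeomorphism_symD[OF h]]) auto
    then show "inv\<^bsub>BijGroup K\<^esub> f \<in> {f \<in> Bij K. \<exists>g. homeomorphism K K f g}"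
      using f by (auto simp: inv_BijGroup restrict_inv_into_Bij)
  next
    fix f g
    assume "f \<in> {f \<in> Bij K. \<exists>g. homeomorphism K K f g}"
      and "g \<in> {f \<in> Bij K. \<exists>g. homeomorphism K K f g}"
    then obtain f' g' where f: "f \<in> Bij K" "homeomorphism K K f f'"
      and g: "g \<in> Bij K" "homeomorphism K K g g'" by blast
    have "homeomorphism K K (compose K f g) (g' \<circ> f')"
      by (rule homeomorphism_cong[OF homeomorphism_compose[OF g(2) f(2)]])
        (auto simp: compose_def)
    then show "f \<otimes>\<^bsub>BijGroup K\<^esub> g \<in> {f \<in> Bij K. \<exists>g. homeomorphism K K f g}"
      using f(1) g(1) by (auto simp: BijGroup_def compose_Bij)
  qed (auto simp: BijGroup_def)
qed

lemma group_homeo_group: "group (homeo_group K)"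
  unfolding homeo_group_def
  by (rule subgroup.subgroup_is_group[OF subgroup_homeo_group group_BijGroup])


section \<open>Binate groups\<close>

definition binate :: "('a, 'b) monoid_scheme \<Rightarrow> bool"
  where "binate G \<longleftrightarrow> group G \<and>
    (\<forall>H. subgroup H G \<and> (\<exists>S. finite S \<and> S \<subseteq> carrier G \<and> H = generate G S) \<longrightarrow>
      (\<exists>\<phi>\<in>hom (G\<lparr>carrier := H\<rparr>) G. \<exists>\<gamma>\<in>carrier G.
        \<forall>h\<in>H. h = inv\<^bsub>G\<^esub> \<gamma> \<otimes>\<^bsub>G\<^esub> inv\<^bsub>G\<^esub> (\<phi> h) \<otimes>\<^bsub>G\<^esub> \<gamma> \<otimes>\<^bsub>G\<^esub> \<phi> h))"


section \<open>Bounded cohomology with real coefficients\<close>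

text \<open>An element \<open>(g\<^sub>0, \<dots>, g\<^sub>n)\<close> of \<open>G\<close> to the power \<open>n + 1\<close> is a list of length
  \<open>n + 1\<close>, and a cochain is a function on such lists, \<^const>\<open>undefined\<close> elsewhere.\<close>

definition tuples :: "('a, 'b) monoid_scheme \<Rightarrow> nat \<Rightarrow> 'a list set"
  where "tuples G n = {xs \<in> lists (carrier G). length xs = Suc n}"

definition bounded_cochains :: "('a, 'b) monoid_scheme \<Rightarrow> nat \<Rightarrow> ('a list \<Rightarrow> real) set"
  where "bounded_cochains G n =
    {f \<in> extensional (tuples G n). \<exists>B. \<forall>xs\<in>tuples G n. \<bar>f xs\<bar> \<le> B}"

definition cochain_action ::
  "('a, 'b) monoid_scheme \<Rightarrow> nat \<Rightarrow> 'a \<Rightarrow> ('a list \<Rightarrow> real) \<Rightarrow> 'a list \<Rightarrow> real"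
  where "cochain_action G n g f =
    (\<lambda>xs\<in>tuples G n. f (map (\<lambda>x. inv\<^bsub>G\<^esub> g \<otimes>\<^bsub>G\<^esub> x) xs))"

definition coboundary ::
  "('a, 'b) monoid_scheme \<Rightarrow> nat \<Rightarrow> ('a list \<Rightarrow> real) \<Rightarrow> 'a list \<Rightarrow> real"
  where "coboundary G n f =
    (\<lambda>xs\<in>tuples G (Suc n). \<Sum>i\<le>Suc n. (-1) ^ i * f (take i xs @ drop (Suc i) xs))"

text \<open>The additive group of the invariants; the scalar multiplication plays no role for
  the vanishing of cohomology.\<close>

definition invariant_cochain_group ::
  "('a, 'b) monoid_scheme \<Rightarrow> nat \<Rightarrow> ('a list \<Rightarrow> real) monoid"
  where "invariant_cochain_group G n =
    \<lparr>carrier = {f \<in> bounded_cochains G n. \<forall>g\<in>carrier G. cochain_action G n g f = f},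
     mult = (\<lambda>f g. \<lambda>xs\<in>tuples G n. f xs + g xs),
     one = (\<lambda>xs\<in>tuples G n. 0)\<rparr>"

definition bounded_cocycles :: "('a, 'b) monoid_scheme \<Rightarrow> nat \<Rightarrow> ('a list \<Rightarrow> real) set"
  where "bounded_cocycles G n =
    kernel (invariant_cochain_group G n) (invariant_cochain_group G (Suc n)) (coboundary G n)"

definition bounded_coboundaries :: "('a, 'b) monoid_scheme \<Rightarrow> nat \<Rightarrow> ('a list \<Rightarrow> real) set"
  where "bounded_coboundaries G n =
    (case n of
       0 \<Rightarrow> {\<one>\<^bsub>invariant_cochain_group G 0\<^esub>}
     | Suc m \<Rightarrow> coboundary G m ` carrier (invariant_cochain_group G m))"

definition bounded_cohomology ::
  "('a, 'b) monoid_scheme \<Rightarrow> nat \<Rightarrow> ('a list \<Rightarrow> real) set monoid"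
  where "bounded_cohomology G n =
    (invariant_cochain_group G n)\<lparr>carrier := bounded_cocycles G n\<rparr> Mod bounded_coboundaries G n"

definition boundedly_acyclic :: "('a, 'b) monoid_scheme \<Rightarrow> bool"
  where "boundedly_acyclic G \<longleftrightarrow>
    group G \<and> (\<forall>n\<ge>1. trivial_group (bounded_cohomology G n))"

end

theory Submission
  imports Defs
begin

text \<open>Write \<open>G\<close> for the group of homeomorphisms of \<open>K\<close> that are the identity near \<open>z\<close>.  A finite
  subset of \<open>G\<close> is supported in one clopen set \<open>A\<close> that misses \<open>z\<close>, and next to \<open>A\<close> there is room in
  \<open>K - {z}\<close> for a clopen set \<open>W\<close> homeomorphic to \<open>A \<times> {0, \<dots>, 1/4, 1/3, 1/2}\<close>: infinitely many copies
  of \<open>A\<close> that accumulate at a last copy \<open>A \<times> {0}\<close>.  This exists because nonempty Cantor sets are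
  homeomorphic (\<open>cantor_sets_homeomorphic\<close>).  Two constructions use this picture.  A
  homeomorphism \<open>h\<close> supported in \<open>A\<close> can act on \<open>A\<close> and on all its copies at once, the last
  copy making the result continuous; this is the homomorphism \<open>infinite_copy\<close>.  And \<open>shift\<close> moves every
  copy to the preceding one, so that \<open>W\<close> is mapped onto \<open>A \<union> W\<close>, while \<open>A\<close> itself is
  pushed into a further clopen set \<open>V\<close> that absorbs it, \<open>A \<union> V\<close> and \<open>V\<close> being homeomorphic.
  Conjugating \<open>infinite_copy h\<close> by \<open>shift\<close> removes exactly the action on \<open>A\<close>, so \<open>h\<close> is the commutator
  of \<open>shift\<close> and \<open>infinite_copy h\<close>, and \<open>G\<close> is binate.

  The inverse of \<open>shift\<close> carries \<open>A\<close> into \<open>W\<close>, off \<open>A\<close>.  Hence every finite subset of \<open>G\<close> commutes with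
  one of its own conjugates, and this property alone, \<open>commuting_conjugates\<close>, forces bounded
  acyclicity.  By iteration, a finite set \<open>S\<close> has \<open>N\<close> conjugates by elements \<open>g\<^sub>0, \<dots>, g\<^sub>N\<^sub>-\<^sub>1\<close> that
  commute with each other.  A bounded invariant cocycle \<open>f\<close> in \<open>n + 1\<close> variables changes
  only by the coboundary of an invariant cochain, with a bound that depends on \<open>n\<close> and the norm of \<open>f\<close>
  alone, when each variable is multiplied on the right by an independent
  random element of \<open>G\<close>: the prism operator gives the primitive.  Choose the random element
  so that, up to left multiplication by \<open>g\<^sub>j\<close>, the variable \<open>x\<close> becomes the product over \<open>i < N\<close> of
  conjugates by \<open>g\<^sub>i\<close> of random elements of \<open>S\<close>, in which \<open>x\<close> stands in place \<open>j\<close>.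
  The averaged cocycle \<open>b\<^sub>j\<close> is then the conditional expectation of one bounded function of \<open>N\<close>
  independent variables, each with values in the \<open>(n + 1)\<close>-tuples over \<open>S\<close>, given the value of the
  \<open>j\<close>-th variable.  The centred functions \<open>b\<^sub>j\<close> are orthogonal to each other, so by Bessel's
  inequality their variances have a sum that is bounded independently of \<open>N\<close>.  For large \<open>N\<close> some
  \<open>b\<^sub>j\<close> is therefore almost constant on the tuples over \<open>S\<close>
  (\<open>exists_nearly_constant_conditional_mean\<close>, \<open>almost_constant_up_to_coboundary\<close>), and constant
  cocycles of positive degree are coboundaries.  Since the bound on the primitives does not
  depend on \<open>S\<close> or on the error, Tychonoff's theorem provides an exact primitive.\<close>

section \<open>Homogeneous cochains on lists\<close>

text \<open>The alternating sum over the omitted entry, for lists of any length.  The recursion on the first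
  entry, in which \<open>\<lambda>ys. f (x # ys)\<close> is a cone construction, reduces every identity below to an
  induction over lists with \<open>f\<close> arbitrary.\<close>

primrec cobd :: "'a list \<Rightarrow> ('a list \<Rightarrow> real) \<Rightarrow> real" where
  "cobd [] f = 0"
| "cobd (x # xs) f = f xs - cobd xs (\<lambda>ys. f (x # ys))"

lemma cobd_eq_sum: "cobd xs f = (\<Sum>i<length xs. (-1) ^ i * f (take i xs @ drop (Suc i) xs))"
proof (induction xs arbitrary: f)
  case (Cons x xs)
  show ?case
    by (simp add: Cons.IH sum.lessThan_Suc_shift sum_negf[symmetric] del: sum.lessThan_Suc)
qed simp

lemma cobd_add: "cobd xs (\<lambda>ys. f ys + g ys) = cobd xs f + cobd xs g"
  by (simp add: cobd_eq_sum algebra_simps sum.distrib)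

lemma cobd_diff: "cobd xs (\<lambda>ys. f ys - g ys) = cobd xs f - cobd xs g"
  by (simp add: cobd_eq_sum algebra_simps sum_subtractf)

lemma cobd_uminus: "cobd xs (\<lambda>ys. - f ys) = - cobd xs f"
  by (simp add: cobd_eq_sum sum_negf)

lemma cobd_scale: "cobd xs (\<lambda>ys. c * f ys) = c * cobd xs f"
  by (simp add: cobd_eq_sum sum_distrib_left algebra_simps)

lemma cobd_sum: "cobd xs (\<lambda>ys. \<Sum>i\<in>I. f i ys) = (\<Sum>i\<in>I. cobd xs (f i))"
  by (simp add: cobd_eq_sum sum_distrib_left sum.swap[of _ I])

text \<open>A nonzero constant cochain is a coboundary in even degree and not a cocycle in odd degree.\<close>

lemma cobd_const: "cobd xs (\<lambda>ys. c) = (if odd (length xs) then c else 0)"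
  by (induction xs) auto

lemma cobd_map: "cobd xs (\<lambda>ys. f (map g ys)) = cobd (map g xs) f"
  by (induction xs arbitrary: f) auto

lemma cobd_cong:
  assumes "\<And>ys. set ys \<subseteq> A \<Longrightarrow> Suc (length ys) = length xs \<Longrightarrow> f ys = g ys" and "set xs \<subseteq> A"
  shows "cobd xs f = cobd xs g"
  using assms
proof (induction xs arbitrary: f g)
  case (Cons x xs)
  have "cobd xs (\<lambda>ys. f (x # ys)) = cobd xs (\<lambda>ys. g (x # ys))"
    using Cons.prems by (intro Cons.IH) auto
  then show ?case using Cons.prems by auto
qed simp

lemma cobd_cobd: "cobd xs (\<lambda>ys. cobd ys f) = 0"
  by (induction xs arbitrary: f) (auto simp: cobd_diff)

lemma cobd_bound:
  fixes B :: real
  assumes "\<And>ys. set ys \<subseteq> A \<Longrightarrow> Suc (length ys) = length xs \<Longrightarrow> \<bar>f ys\<bar> \<le> B" and "set xs \<subseteq> A"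
  shows "\<bar>cobd xs f\<bar> \<le> length xs * B"
  using assms
proof (induction xs arbitrary: f)
  case (Cons x xs)
  have "\<bar>cobd xs (\<lambda>ys. f (x # ys))\<bar> \<le> length xs * B"
    using Cons.prems by (intro Cons.IH) auto
  moreover have "\<bar>f xs\<bar> \<le> B" using Cons.prems by auto
  ultimately show ?case by (simp add: algebra_simps)
qed simp

text \<open>On the list of pairs \<open>(x\<^sub>0, y\<^sub>0), \<dots>, (x\<^sub>n, y\<^sub>n)\<close> this is the sum over \<open>i\<close> of
  \<open>(-1)\<^sup>i f(x\<^sub>0, \<dots>, x\<^sub>i, y\<^sub>i, \<dots>, y\<^sub>n)\<close>, the usual subdivision of a prism between two simplices.\<close>

primrec prism :: "('a \<times> 'a) list \<Rightarrow> ('a list \<Rightarrow> real) \<Rightarrow> real" where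
  "prism [] f = 0"
| "prism (z # zs) f = f (fst z # snd z # map snd zs) - prism zs (\<lambda>ys. f (fst z # ys))"

lemma prism_diff: "prism zs (\<lambda>ys. f ys - g ys) = prism zs f - prism zs g"
  by (induction zs arbitrary: f g) auto

text \<open>The primitive produced for a cocycle \<open>f\<close> is a function of pairs.  It becomes a cochain of the group once \<open>y\<close> is
  determined by \<open>x\<close>, or averaged over a distribution depending on \<open>x\<close>.\<close>

lemma prism_homotopy:
  "cobd zs (\<lambda>us. prism us f) + prism zs (\<lambda>ys. cobd ys f) = f (map snd zs) - f (map fst zs)"
proof (induction zs arbitrary: f)
  case (Cons z zs)
  let ?fx = "\<lambda>ys. f (fst z # ys)" and ?ys = "map snd zs"
  have "cobd zs (\<lambda>us. f (fst z # snd z # map snd us)) = cobd ?ys (\<lambda>ys. f (fst z # snd z # ys))"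
    by (rule cobd_map)
  then show ?case
    using Cons.IH[of ?fx] by (simp add: cobd_diff prism_diff)
qed simp

lemma prism_map: "prism (map (map_prod u u) zs) f = prism zs (\<lambda>ys. f (map u ys))"
  by (induction zs arbitrary: f) (auto simp: comp_def)

lemma prism_cong:
  assumes "\<And>ys. set ys \<subseteq> A \<Longrightarrow> length ys = Suc (length zs) \<Longrightarrow> f ys = g ys" and "set zs \<subseteq> A \<times> A"
  shows "prism zs f = prism zs g"
  using assms
proof (induction zs arbitrary: f g)
  case (Cons z zs)
  have "prism zs (\<lambda>ys. f (fst z # ys)) = prism zs (\<lambda>ys. g (fst z # ys))"
    using Cons.prems by (intro Cons.IH) auto
  moreover have "f (fst z # snd z # map snd zs) = g (fst z # snd z # map snd zs)"
    using Cons.prems by (intro Cons.prems(1)) auto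
  ultimately show ?case by simp
qed simp

lemma prism_bound:
  fixes B :: real
  assumes "\<And>ys. set ys \<subseteq> A \<Longrightarrow> length ys = Suc (length zs) \<Longrightarrow> \<bar>f ys\<bar> \<le> B" and "set zs \<subseteq> A \<times> A"
  shows "\<bar>prism zs f\<bar> \<le> length zs * B"
  using assms
proof (induction zs arbitrary: f)
  case (Cons z zs)
  have "\<bar>prism zs (\<lambda>ys. f (fst z # ys))\<bar> \<le> length zs * B"
    using Cons.prems by (intro Cons.IH) auto
  moreover have "\<bar>f (fst z # snd z # map snd zs)\<bar> \<le> B"
    using Cons.prems by (intro Cons.prems(1)) auto
  ultimately show ?case by (simp add: algebra_simps)
qed simp

text \<open>The expectation of \<open>q\<close> when each entry of \<open>xs\<close> receives an independent label, uniformly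
  distributed in \<open>R\<close>.\<close>

definition label_mean :: "'r set \<Rightarrow> 'x list \<Rightarrow> (('x \<times> 'r) list \<Rightarrow> real) \<Rightarrow> real" where
  "label_mean R xs q = (\<Sum>rs | set rs \<subseteq> R \<and> length rs = length xs. q (zip xs rs)) / real (card R) ^ length xs"

lemma sum_lists_Suc:
  fixes g :: "'r list \<Rightarrow> real"
  shows "(\<Sum>rs | set rs \<subseteq> R \<and> length rs = Suc n. g rs) =
    (\<Sum>r\<in>R. \<Sum>rs | set rs \<subseteq> R \<and> length rs = n. g (r # rs))"
proof -
  have "inj_on (\<lambda>(xs, n). n # xs) ({xs. set xs \<subseteq> R \<and> length xs = n} \<times> R)"
    by (auto simp: inj_on_def)
  then have "(\<Sum>rs | set rs \<subseteq> R \<and> length rs = Suc n. g rs) =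
     (\<Sum>(rs, r)\<in>{rs. set rs \<subseteq> R \<and> length rs = n} \<times> R. g (r # rs))"
    unfolding lists_length_Suc_eq by (subst sum.reindex) (auto simp: case_prod_unfold)
  also have "\<dots> = (\<Sum>rs | set rs \<subseteq> R \<and> length rs = n. \<Sum>r\<in>R. g (r # rs))"
    by (simp add: sum.cartesian_product)
  finally show ?thesis by (simp add: sum.swap[of _ _ R])
qed

lemma label_mean_Nil [simp]: "label_mean R [] q = q []"
proof -
  have "{rs. set rs \<subseteq> R \<and> length rs = 0} = {[]}" by auto
  then show ?thesis by (simp add: label_mean_def)
qed

lemma label_mean_Cons: "label_mean R (x # xs) q = (\<Sum>r\<in>R. label_mean R xs (\<lambda>zs. q ((x, r) # zs))) / card R"
  by (simp add: label_mean_def sum_lists_Suc sum_divide_distrib mult.commute)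

lemma label_mean_diff: "label_mean R xs (\<lambda>zs. f zs - g zs) = label_mean R xs f - label_mean R xs g"
  by (simp add: label_mean_def sum_subtractf diff_divide_distrib)

lemma label_mean_const:
  assumes "finite R" "R \<noteq> {}"
  shows "label_mean R xs (\<lambda>zs. c) = c"
  using assms by (simp add: label_mean_def card_lists_length_eq)

lemma label_mean_cong:
  assumes "\<And>zs. set zs \<subseteq> set xs \<times> R \<Longrightarrow> map fst zs = xs \<Longrightarrow> f zs = g zs"
  shows "label_mean R xs f = label_mean R xs g"
  unfolding label_mean_def
  by (intro arg_cong2[where f = "(/)"] sum.cong refl assms)
    (auto dest: set_zip_leftD set_zip_rightD)

lemma label_mean_bound:
  assumes R: "finite R" "R \<noteq> {}"
    and "\<And>zs. set zs \<subseteq> set xs \<times> R \<Longrightarrow> map fst zs = xs \<Longrightarrow> \<bar>f zs\<bar> \<le> B"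
  shows "\<bar>label_mean R xs f\<bar> \<le> B"
proof -
  have "\<bar>\<Sum>rs | set rs \<subseteq> R \<and> length rs = length xs. f (zip xs rs)\<bar>
      \<le> of_nat (card {rs. set rs \<subseteq> R \<and> length rs = length xs}) * B"
    by (intro order.trans[OF sum_abs] sum_bounded_above assms(3))
      (auto dest: set_zip_leftD set_zip_rightD)
  then show ?thesis
    using R by (simp add: label_mean_def card_lists_length_eq field_simps card_gt_0_iff)
qed

lemma label_mean_map: "label_mean R (map g xs) q = label_mean R xs (\<lambda>zs. q (map (map_prod g id) zs))"
  by (simp add: label_mean_def zip_map1 case_prod_unfold map_prod_def)

text \<open>Omitting an entry together with its label leaves independent uniform labels on the others.\<close>

lemma label_mean_cobd:
  assumes "finite R" "R \<noteq> {}"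
  shows "label_mean R xs (\<lambda>zs. cobd zs q) = cobd xs (\<lambda>ys. label_mean R ys q)"
proof (induction xs arbitrary: q)
  case (Cons x xs)
  have "label_mean R (x # xs) (\<lambda>zs. cobd zs q) =
      (\<Sum>r\<in>R. label_mean R xs q - cobd xs (\<lambda>ys. label_mean R ys (\<lambda>zs. q ((x, r) # zs)))) / card R"
    by (simp add: label_mean_Cons label_mean_diff Cons.IH)
  also have "\<dots> = label_mean R xs q - (\<Sum>r\<in>R. cobd xs (\<lambda>ys. label_mean R ys (\<lambda>zs. q ((x, r) # zs)))) / card R"
    using assms by (simp add: sum_subtractf diff_divide_distrib)
  also have "\<dots> = label_mean R xs q - cobd xs (\<lambda>ys. label_mean R (x # ys) q)"
    using cobd_scale[of xs "1 / card R" "\<lambda>ys. \<Sum>r\<in>R. label_mean R ys (\<lambda>zs. q ((x, r) # zs))"]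
    by (simp add: label_mean_Cons cobd_sum)
  finally show ?case by simp
qed simp

section \<open>An inequality of Bessel type\<close>

text \<open>The finite probability space \<open>W\<close> has \<open>N\<close> coordinates \<open>Z\<^sub>j\<close> with values in \<open>T\<close>, and \<open>R j w t\<close> resets
  the \<open>j\<close>-th coordinate of \<open>w\<close> to \<open>t\<close>, so that \<open>(w, t) \<mapsto> (R j w t, Z j w)\<close> is an involution.  This
  makes the coordinates uniform and independent.  The average of \<open>F (R j w t)\<close> over \<open>w\<close> is the
  conditional expectation of \<open>F\<close> given \<open>Z\<^sub>j = t\<close>.  The centred conditional expectations are
  pairwise orthogonal in \<open>L\<^sup>2(W)\<close> and each is a projection of \<open>F\<close>, so the sum of their squared norms is at
  most that of \<open>F\<close>, and the smallest of \<open>N\<close> terms is at most the \<open>N\<close>-th part of it.\<close>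

lemma exists_nearly_constant_conditional_mean:
  fixes F :: "'w \<Rightarrow> real" and Z :: "nat \<Rightarrow> 'w \<Rightarrow> 't" and R :: "nat \<Rightarrow> 'w \<Rightarrow> 't \<Rightarrow> 'w" and N :: nat and B :: real
  assumes W: "finite W" "W \<noteq> {}" and T: "finite T" "T \<noteq> {}" and N: "N > 0"
    and Z: "\<And>j w. j < N \<Longrightarrow> w \<in> W \<Longrightarrow> Z j w \<in> T"
    and R: "\<And>j w t. j < N \<Longrightarrow> w \<in> W \<Longrightarrow> t \<in> T \<Longrightarrow> R j w t \<in> W"
    and ZR: "\<And>j w t. j < N \<Longrightarrow> w \<in> W \<Longrightarrow> t \<in> T \<Longrightarrow> Z j (R j w t) = t"
    and RR: "\<And>j w t. j < N \<Longrightarrow> w \<in> W \<Longrightarrow> t \<in> T \<Longrightarrow> R j (R j w t) (Z j w) = w"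
    and ZR': "\<And>j k w t. j < N \<Longrightarrow> k < N \<Longrightarrow> j \<noteq> k \<Longrightarrow> w \<in> W \<Longrightarrow> t \<in> T \<Longrightarrow> Z k (R j w t) = Z k w"
    and B: "\<And>w. w \<in> W \<Longrightarrow> \<bar>F w\<bar> \<le> B"
  shows "\<exists>j<N. \<exists>m. \<bar>m\<bar> \<le> B \<and>
    (\<forall>t\<in>T. ((\<Sum>w\<in>W. F (R j w t)) / card W - m)\<^sup>2 \<le> card T * B\<^sup>2 / N)"
proof -
  define b where "b = (\<lambda>j t. (\<Sum>w\<in>W. F (R j w t)) / card W)"
  define m where "m = (\<lambda>j. (\<Sum>t\<in>T. b j t) / card T)"
  define c where "c = (\<lambda>j t. b j t - m j)"
  define V where "V = (\<lambda>j. \<Sum>t\<in>T. (c j t)\<^sup>2)"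
  define u where "u = (\<lambda>j w. c j (Z j w))"
  have cW: "real (card W) > 0" and cT: "real (card T) > 0"
    using W T by (auto simp: card_gt_0_iff)
  have csum: "(\<Sum>t\<in>T. c j t) = 0" for j
    using cT by (simp add: c_def sum_subtractf m_def)
  have resample: "(\<Sum>w\<in>W. \<Sum>t\<in>T. G (R j w t)) = card T * (\<Sum>w\<in>W. G w)" if j: "j < N"
    for j and G :: "'w \<Rightarrow> real"
  proof -
    have "(\<Sum>w\<in>W. \<Sum>t\<in>T. G (R j w t)) = (\<Sum>p\<in>W \<times> T. G (R j (fst p) (snd p)))"
      by (simp add: sum.cartesian_product case_prod_unfold)
    also have "\<dots> = (\<Sum>p\<in>W \<times> T. G (fst p))"
      by (rule sum.reindex_bij_witness[where i = "\<lambda>p. (R j (fst p) (snd p), Z j (fst p))"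
            and j = "\<lambda>p. (R j (fst p) (snd p), Z j (fst p))"])
        (use j in \<open>auto simp: Z R ZR RR\<close>)
    also have "\<dots> = (\<Sum>w\<in>W. \<Sum>t\<in>T. G w)"
      by (simp only: sum.cartesian_product case_prod_unfold)
    finally show ?thesis by (simp add: sum_distrib_left)
  qed
  have Fu: "card T * (\<Sum>w\<in>W. F w * u j w) = card W * V j" if j: "j < N" for j
  proof -
    have "card T * (\<Sum>w\<in>W. F w * u j w) = (\<Sum>w\<in>W. \<Sum>t\<in>T. F (R j w t) * c j t)"
      by (subst resample[OF j, symmetric]) (simp add: u_def ZR j)
    also have "\<dots> = (\<Sum>t\<in>T. (\<Sum>w\<in>W. F (R j w t)) * c j t)"
      by (subst sum.swap) (simp add: sum_distrib_right)
    also have "\<dots> = card W * (\<Sum>t\<in>T. b j t * c j t)"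
      using cW by (simp add: b_def sum_distrib_left)
    also have "(\<Sum>t\<in>T. b j t * c j t) = V j + m j * (\<Sum>t\<in>T. c j t)"
      by (simp add: V_def c_def power2_eq_square algebra_simps sum.distrib sum_subtractf sum_distrib_left)
    finally show ?thesis by (simp add: csum)
  qed
  have uu: "card T * (\<Sum>w\<in>W. u j w * u j w) = card W * V j" if j: "j < N" for j
  proof -
    have "card T * (\<Sum>w\<in>W. u j w * u j w) = (\<Sum>w\<in>W. \<Sum>t\<in>T. c j t * c j t)"
      by (subst resample[OF j, symmetric]) (simp add: u_def ZR j)
    then show ?thesis by (simp add: V_def power2_eq_square)
  qed
  have uv: "(\<Sum>w\<in>W. u j w * u k w) = 0" if j: "j < N" and k: "k < N" and jk: "j \<noteq> k" for j k
  proof -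
    have "card T * (\<Sum>w\<in>W. u j w * u k w) = (\<Sum>w\<in>W. \<Sum>t\<in>T. c j t * u k w)"
      by (subst resample[OF j, symmetric]) (simp add: u_def ZR ZR' j k jk)
    also have "\<dots> = 0" by (simp add: sum_distrib_right[symmetric] csum)
    finally show ?thesis using cT by simp
  qed
  \<comment> \<open>Bessel's inequality, from expanding the square of the distance of \<open>F\<close> to its projection.\<close>
  have "0 \<le> (\<Sum>w\<in>W. (F w - (\<Sum>j<N. u j w))\<^sup>2)"
    by (intro sum_nonneg) auto
  also have "\<dots> = (\<Sum>w\<in>W. (F w)\<^sup>2) - 2 * (\<Sum>j<N. \<Sum>w\<in>W. F w * u j w)
      + (\<Sum>j<N. \<Sum>k<N. \<Sum>w\<in>W. u j w * u k w)"
  proof -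
    have "(\<Sum>w\<in>W. F w * (2 * (\<Sum>j<N. u j w))) = 2 * (\<Sum>j<N. \<Sum>w\<in>W. F w * u j w)"
      by (simp add: sum_distrib_left sum.swap[of _ W] algebra_simps)
    moreover have "(\<Sum>w\<in>W. (\<Sum>j<N. u j w) * (\<Sum>j<N. u j w)) = (\<Sum>j<N. \<Sum>k<N. \<Sum>w\<in>W. u j w * u k w)"
      by (simp add: sum_product sum.swap[of _ _ W])
    ultimately show ?thesis
      by (simp add: power2_eq_square algebra_simps sum.distrib sum_subtractf sum_distrib_left[symmetric])
  qed
  also have "(\<Sum>j<N. \<Sum>k<N. \<Sum>w\<in>W. u j w * u k w) = (\<Sum>j<N. \<Sum>w\<in>W. u j w * u j w)"
  proof (intro sum.cong refl)
    fix j assume "j \<in> {..<N}"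
    then have "(\<Sum>k<N. \<Sum>w\<in>W. u j w * u k w) = (\<Sum>k<N. if k = j then \<Sum>w\<in>W. u j w * u j w else 0)"
      by (intro sum.cong) (auto simp: uv)
    then show "(\<Sum>k<N. \<Sum>w\<in>W. u j w * u k w) = (\<Sum>w\<in>W. u j w * u j w)"
      using \<open>j \<in> {..<N}\<close> by (simp add: sum.delta)
  qed
  also have "(\<Sum>j<N. \<Sum>w\<in>W. u j w * u j w) = (\<Sum>j<N. \<Sum>w\<in>W. F w * u j w)"
  proof (rule sum.cong[OF refl])
    fix j assume "j \<in> {..<N}"
    then have "card T * (\<Sum>w\<in>W. u j w * u j w) = card T * (\<Sum>w\<in>W. F w * u j w)"
      using Fu uu by (simp only: lessThan_iff)
    then show "(\<Sum>w\<in>W. u j w * u j w) = (\<Sum>w\<in>W. F w * u j w)"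
      using cT by (simp only: mult_cancel_left) linarith
  qed
  also have "(\<Sum>j<N. \<Sum>w\<in>W. F w * u j w) = (\<Sum>j<N. card W * V j / card T)"
    using Fu cT by (intro sum.cong refl) (simp add: field_simps)
  finally have "(\<Sum>j<N. card W * V j / card T) \<le> (\<Sum>w\<in>W. (F w)\<^sup>2)"
    by linarith
  also have "\<dots> \<le> card W * B\<^sup>2"
  proof (rule sum_bounded_above)
    fix w assume "w \<in> W"
    from B[OF this] have "\<bar>F w\<bar> \<le> \<bar>B\<bar>" by linarith
    then show "(F w)\<^sup>2 \<le> B\<^sup>2" by (simp only: abs_le_square_iff)
  qed
  finally have "(\<Sum>j<N. card W * V j / card T) \<le> card W * B\<^sup>2" .
  moreover have "(\<Sum>j<N. card W * V j / card T) = card W * ((\<Sum>j<N. V j) / card T)"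
    by (simp add: sum_distrib_left sum_divide_distrib)
  ultimately have "card W * ((\<Sum>j<N. V j) / card T) \<le> card W * B\<^sup>2"
    by (simp only:)
  then have "(\<Sum>j<N. V j) / card T \<le> B\<^sup>2"
    using cW by (simp only: mult_le_cancel_left_pos)
  then have "(\<Sum>j<N. V j) \<le> card T * B\<^sup>2"
    using cT by (simp add: pos_divide_le_eq mult.commute)
  then have "\<exists>j<N. V j \<le> card T * B\<^sup>2 / N"
  proof (rule contrapos_pp)
    assume "\<not> (\<exists>j<N. V j \<le> card T * B\<^sup>2 / N)"
    then have "(\<Sum>j<N. card T * B\<^sup>2 / N) < (\<Sum>j<N. V j)"
      using N by (intro sum_strict_mono) (auto simp: not_le)
    then show "\<not> (\<Sum>j<N. V j) \<le> card T * B\<^sup>2"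
      using N by simp
  qed
  then obtain j where j: "j < N" and V: "V j \<le> card T * B\<^sup>2 / N" by blast
  have b: "\<bar>b j t\<bar> \<le> B" if t: "t \<in> T" for t
  proof -
    have "(\<Sum>w\<in>W. \<bar>F (R j w t)\<bar>) \<le> card W * B"
      by (rule sum_bounded_above) (rule B[OF R[OF j _ t]])
    then have "\<bar>\<Sum>w\<in>W. F (R j w t)\<bar> \<le> card W * B"
      by (rule order.trans[OF sum_abs])
    then show ?thesis
      using cW by (simp add: b_def abs_divide pos_divide_le_eq mult.commute)
  qed
  have "(\<Sum>t\<in>T. \<bar>b j t\<bar>) \<le> card T * B"
    by (rule sum_bounded_above) (rule b)
  then have "\<bar>\<Sum>t\<in>T. b j t\<bar> \<le> card T * B"
    by (rule order.trans[OF sum_abs])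
  then have "\<bar>m j\<bar> \<le> B"
    using cT by (simp add: m_def abs_divide pos_divide_le_eq mult.commute)
  moreover have "(c j t)\<^sup>2 \<le> card T * B\<^sup>2 / N" if t: "t \<in> T" for t
  proof -
    have "(c j t)\<^sup>2 \<le> V j"
      unfolding V_def by (rule member_le_sum[OF t zero_le_power2 T(1)])
    then show ?thesis using V by linarith
  qed
  ultimately have "\<bar>m j\<bar> \<le> B \<and> (\<forall>t\<in>T. (b j t - m j)\<^sup>2 \<le> card T * B\<^sup>2 / N)"
    by (simp add: c_def)
  then show ?thesis
    using j unfolding b_def by blast
qed

section \<open>Groups with commuting conjugates\<close>

definition tuple_lists :: "'c set \<Rightarrow> nat \<Rightarrow> 'c list set" where
  "tuple_lists A n = {xs. set xs \<subseteq> A \<and> length xs = n}"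

definition commuting_conjugates :: "('a, 'b) monoid_scheme \<Rightarrow> bool"
  where "commuting_conjugates G \<longleftrightarrow>
    (\<forall>S. finite S \<and> S \<subseteq> carrier G \<longrightarrow> (\<exists>g\<in>carrier G. \<forall>s\<in>S. \<forall>t\<in>S.
      s \<otimes>\<^bsub>G\<^esub> (g \<otimes>\<^bsub>G\<^esub> t \<otimes>\<^bsub>G\<^esub> inv\<^bsub>G\<^esub> g) = (g \<otimes>\<^bsub>G\<^esub> t \<otimes>\<^bsub>G\<^esub> inv\<^bsub>G\<^esub> g) \<otimes>\<^bsub>G\<^esub> s))"

context group
begin

definition conj_by :: "'a \<Rightarrow> 'a \<Rightarrow> 'a" where "conj_by g s = g \<otimes> s \<otimes> inv g"

lemma conj_by_closed [simp]: "g \<in> carrier G \<Longrightarrow> s \<in> carrier G \<Longrightarrow> conj_by g s \<in> carrier G"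
  by (simp add: conj_by_def)

lemma conj_by_one [simp]: "g \<in> carrier G \<Longrightarrow> conj_by g \<one> = \<one>"
  by (simp add: conj_by_def)

definition commuting_family :: "nat \<Rightarrow> (nat \<Rightarrow> 'a) \<Rightarrow> 'a set \<Rightarrow> bool" where
  "commuting_family N g S \<longleftrightarrow> (\<forall>i<N. g i \<in> carrier G) \<and>
    (\<forall>i<N. \<forall>j<N. i \<noteq> j \<longrightarrow> (\<forall>s\<in>S. \<forall>t\<in>S.
      conj_by (g i) s \<otimes> conj_by (g j) t = conj_by (g j) t \<otimes> conj_by (g i) s))"

text \<open>The next conjugator is chosen for the union of \<open>S\<close> with all conjugates found so far.\<close>

lemma ex_commuting_family:
  assumes G: "commuting_conjugates G" and S: "finite S" "S \<subseteq> carrier G"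
  shows "\<exists>g. commuting_family N g S"
proof (induction N)
  case 0
  show ?case by (auto simp: commuting_family_def)
next
  case (Suc N)
  then obtain g where g: "commuting_family N g S" by blast
  define S' where "S' = S \<union> (\<Union>i<N. conj_by (g i) ` S)"
  have "finite S'" "S' \<subseteq> carrier G"
    using S g by (auto simp: S'_def commuting_family_def)
  then obtain h where h: "h \<in> carrier G"
    and comm: "\<And>s t. s \<in> S' \<Longrightarrow> t \<in> S' \<Longrightarrow> s \<otimes> conj_by h t = conj_by h t \<otimes> s"
    using G unfolding commuting_conjugates_def conj_by_def by meson
  have comm': "conj_by (g i) s \<otimes> conj_by h t = conj_by h t \<otimes> conj_by (g i) s"
    if "i < N" "s \<in> S" "t \<in> S" for i s t
    using that by (intro comm) (auto simp: S'_def)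
  have "commuting_family (Suc N) (g(N := h)) S"
    using g h comm' comm'[symmetric] by (auto simp: commuting_family_def less_Suc_eq)
  then show ?case by blast
qed

primrec prod_conj :: "(nat \<Rightarrow> 'a) \<Rightarrow> (nat \<Rightarrow> 'a) \<Rightarrow> nat \<Rightarrow> 'a" where
  "prod_conj g y 0 = \<one>"
| "prod_conj g y (Suc N) = prod_conj g y N \<otimes> conj_by (g N) (y N)"

lemma prod_conj_closed [simp]:
  assumes "\<And>i. i < N \<Longrightarrow> g i \<in> carrier G" "\<And>i. i < N \<Longrightarrow> y i \<in> carrier G"
  shows "prod_conj g y N \<in> carrier G"
  using assms by (induction N) auto

lemma prod_conj_cong: "(\<And>i. i < N \<Longrightarrow> y i = y' i) \<Longrightarrow> prod_conj g y N = prod_conj g y' N"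
  by (induction N) auto

lemma prod_conj_commute:
  assumes g: "commuting_family K g S" and S: "S \<subseteq> carrier G"
    and N: "N \<le> i" "i < K" and y: "\<And>j. j < N \<Longrightarrow> y j \<in> S" and x: "x \<in> S"
  shows "prod_conj g y N \<otimes> conj_by (g i) x = conj_by (g i) x \<otimes> prod_conj g y N"
  using N y
proof (induction N)
  case 0
  then show ?case using g x S by (auto simp: commuting_family_def)
next
  case (Suc N)
  have gc: "\<And>i. i < K \<Longrightarrow> g i \<in> carrier G" using g by (auto simp: commuting_family_def)
  define p a b where "p = prod_conj g y N" and "a = conj_by (g N) (y N)" and "b = conj_by (g i) x"
  have c: "p \<in> carrier G" "a \<in> carrier G" "b \<in> carrier G"
    using Suc.prems S x gc unfolding p_def a_def b_def
    by (auto intro!: prod_conj_closed simp: less_Suc_eq subset_iff)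
  have pb: "p \<otimes> b = b \<otimes> p" using Suc by (simp add: p_def b_def)
  have ab: "a \<otimes> b = b \<otimes> a"
    using g Suc.prems x unfolding a_def b_def commuting_family_def by auto
  have "p \<otimes> a \<otimes> b = b \<otimes> (p \<otimes> a)"
    using c pb ab by (metis m_assoc)
  then show ?case by (simp add: p_def a_def b_def)
qed

text \<open>Because the conjugates commute, the \<open>i\<close>-th factor can be moved to the front.  So the product
  with \<open>x\<close> in place \<open>i\<close> differs from \<open>x\<close> only by multiplications that do not involve \<open>x\<close>.\<close>

lemma prod_conj_upd:
  assumes g: "commuting_family K g S" and S: "S \<subseteq> carrier G" "\<one> \<in> S"
    and N: "i < N" "N \<le> K" and y: "\<And>j. j < N \<Longrightarrow> y j \<in> S" and x: "x \<in> S"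
  shows "prod_conj g (y(i := x)) N = conj_by (g i) x \<otimes> prod_conj g (y(i := \<one>)) N"
  using N y
proof (induction N)
  case (Suc N)
  have gc: "\<And>i. i < K \<Longrightarrow> g i \<in> carrier G" using g by (auto simp: commuting_family_def)
  show ?case
  proof (cases "i = N")
    case True
    have "prod_conj g (y(N := x)) N = prod_conj g y N" "prod_conj g (y(N := \<one>)) N = prod_conj g y N"
      by (auto intro: prod_conj_cong)
    moreover have "prod_conj g y N \<in> carrier G"
      using Suc.prems gc S by (intro prod_conj_closed) (auto simp: subset_iff)
    ultimately show ?thesis
      using True Suc.prems gc prod_conj_commute[OF g S(1) _ _ _ x, of N N y]
      by (simp add: fun_upd_same del: fun_upd_apply)
  next
    case False
    have "prod_conj g (y(i := \<one>)) N \<in> carrier G" "conj_by (g i) x \<in> carrier G"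
      "conj_by (g N) (y N) \<in> carrier G"
      using Suc.prems gc S x by (auto intro!: prod_conj_closed simp: subset_iff)
    then show ?thesis using False Suc by (simp add: m_assoc del: fun_upd_apply) (simp add: m_assoc)
  qed
qed simp

text \<open>Cochains are indexed here by the number \<open>k\<close> of their variables, one more than the degree.\<close>

definition invariant_on_tuples :: "nat \<Rightarrow> ('a list \<Rightarrow> real) \<Rightarrow> bool" where
  "invariant_on_tuples k f \<longleftrightarrow>
    (\<forall>a\<in>carrier G. \<forall>xs\<in>tuple_lists (carrier G) k. f (map ((\<otimes>) a) xs) = f xs)"

definition invariant_cocycle :: "nat \<Rightarrow> real \<Rightarrow> ('a list \<Rightarrow> real) \<Rightarrow> bool" where
  "invariant_cocycle k B f \<longleftrightarrow> invariant_on_tuples k f \<and>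
    (\<forall>xs\<in>tuple_lists (carrier G) k. \<bar>f xs\<bar> \<le> B) \<and>
    (\<forall>xs\<in>tuple_lists (carrier G) (Suc k). cobd xs f = 0)"

text \<open>The averaging argument.  Labels are functions \<open>y\<close> from \<open>{..<N}\<close> to \<open>S\<close>; the entry \<open>x\<close> with label \<open>y\<close> is
  moved to \<open>x \<otimes> c y\<close>, which up to left multiplication by \<open>g j\<close> is the product of conjugates with \<open>x\<close> in
  place \<open>j\<close>.  Left multiplication does not change \<open>f\<close>, so the mean of \<open>f\<close> over the labels is a
  conditional mean to which \<open>exists_nearly_constant_conditional_mean\<close> applies, with the tuple of
  \<open>j\<close>-th components as \<open>j\<close>-th coordinate.  The primitive \<open>e\<close> is defined and
  invariant on all of \<open>G\<close> and its bound does not mention \<open>S\<close>, as the passage to the limit requires.\<close>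

lemma almost_constant_up_to_coboundary:
  fixes B :: real
  assumes S: "finite S" "S \<subseteq> carrier G" "\<one> \<in> S" and g: "commuting_family N g S" and N: "N > 0"
    and f: "invariant_cocycle (Suc n) B f"
  shows "\<exists>e m. (\<forall>xs\<in>tuple_lists (carrier G) n. \<bar>e xs\<bar> \<le> n * B) \<and>
    invariant_on_tuples n e \<and>
    \<bar>m\<bar> \<le> B \<and>
    (\<forall>xs\<in>tuple_lists S (Suc n). (f xs - cobd xs e - m)\<^sup>2 \<le> real (card S ^ Suc n) * B\<^sup>2 / N)"
proof -
  have bound: "\<And>xs. xs \<in> tuple_lists (carrier G) (Suc n) \<Longrightarrow> \<bar>f xs\<bar> \<le> B"
    and invar: "\<And>a xs. a \<in> carrier G \<Longrightarrow> xs \<in> tuple_lists (carrier G) (Suc n) \<Longrightarrow>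
      f (map ((\<otimes>) a) xs) = f xs"
    and cocycle: "\<And>xs. xs \<in> tuple_lists (carrier G) (Suc (Suc n)) \<Longrightarrow> cobd xs f = 0"
    using f by (auto simp: invariant_cocycle_def invariant_on_tuples_def)
  define R where "R = PiE {..<N} (\<lambda>_. S)"
  define W where "W = tuple_lists R (Suc n)"
  define T where "T = tuple_lists S (Suc n)"
  define Z where "Z = (\<lambda>(j::nat) ys. map (\<lambda>y. y j) ys :: 'a list)"
  define res where "res = (\<lambda>(j::nat) ys xs. map2 (\<lambda>y x. y(j := x :: 'a)) ys xs)"
  define F where "F = (\<lambda>ys. f (map (\<lambda>y. prod_conj g y N) ys))"
  have gc: "\<And>i. i < N \<Longrightarrow> g i \<in> carrier G" using g by (auto simp: commuting_family_def)
  have R: "finite R" "R \<noteq> {}"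
    using S by (auto simp: R_def PiE_eq_empty_iff intro!: finite_PiE)
  have Rupd: "y(j := x) \<in> R" if "y \<in> R" "j < N" "x \<in> S" for y j x
    using that by (auto simp: R_def PiE_iff extensional_def)
  have RS: "y j \<in> S" if "y \<in> R" "j < N" for y j
    using that by (auto simp: R_def PiE_iff)
  have pc: "prod_conj g y N \<in> carrier G" if "y \<in> R" for y
    using RS[OF that] gc S by (intro prod_conj_closed) auto
  have "\<exists>j<N. \<exists>m. \<bar>m\<bar> \<le> B \<and>
    (\<forall>t\<in>T. ((\<Sum>w\<in>W. F (res j w t)) / card W - m)\<^sup>2 \<le> card T * B\<^sup>2 / N)"
  proof (rule exists_nearly_constant_conditional_mean[where Z = Z and F = F and R = res])
    show "finite W" "finite T"
      using R S by (auto simp: W_def T_def tuple_lists_def finite_lists_length_eq)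
    obtain y where "y \<in> R" using R by blast
    then have "replicate (Suc n) y \<in> W" "replicate (Suc n) \<one> \<in> T"
      using S unfolding W_def T_def tuple_lists_def by auto
    then show "W \<noteq> {}" "T \<noteq> {}" by auto
    show "N > 0" by fact
    fix j w assume j: "j < N" and w: "w \<in> W"
    show "Z j w \<in> T"
      using w RS[OF _ j] by (auto simp: Z_def T_def W_def tuple_lists_def)
    fix t assume t: "t \<in> T"
    have len: "length w = length t" using w t by (simp add: W_def T_def tuple_lists_def)
    show "res j w t \<in> W"
    proof -
      have "y(j := x) \<in> R" if "(y, x) \<in> set (zip w t)" for y x
        using set_zip_leftD[OF that] set_zip_rightD[OF that] w t j
        by (intro Rupd) (auto simp: W_def T_def tuple_lists_def)
      then show ?thesis
        using w t by (auto simp: res_def W_def T_def tuple_lists_def)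
    qed
    show "Z j (res j w t) = t" "res j (res j w t) (Z j w) = w"
      using len by (auto simp: Z_def res_def intro!: nth_equalityI)
    show "Z k (res j w t) = Z k w" if "j \<noteq> k" for k
      using len that by (auto simp: Z_def res_def intro!: nth_equalityI)
  next
    fix w assume "w \<in> W"
    then have "map (\<lambda>y. prod_conj g y N) w \<in> tuple_lists (carrier G) (Suc n)"
      using pc by (auto simp: W_def tuple_lists_def)
    then show "\<bar>F w\<bar> \<le> B" unfolding F_def by (rule bound)
  qed
  then obtain j m where j: "j < N" and m: "\<bar>m\<bar> \<le> B"
    and near: "\<And>t. t \<in> T \<Longrightarrow> ((\<Sum>w\<in>W. F (res j w t)) / card W - m)\<^sup>2 \<le> card T * B\<^sup>2 / N"
    by blast
  define c where "c = (\<lambda>y. inv (g j) \<otimes> prod_conj g (y(j := \<one>)) N)"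
  define d where "d = (\<lambda>(x, y). (x, x \<otimes> c y))"
  define e where "e = (\<lambda>xs. - label_mean R xs (\<lambda>zs. prism (map d zs) f))"
  have cc: "c y \<in> carrier G" if "y \<in> R" for y
    using pc[OF Rupd[OF that j \<open>\<one> \<in> S\<close>]] gc j by (simp add: c_def)
  have dc: "set (map d zs) \<subseteq> carrier G \<times> carrier G"
    if "set zs \<subseteq> set xs \<times> R" "set xs \<subseteq> carrier G" for zs xs
    using that cc by (fastforce simp: d_def)
  have e_bound: "\<bar>e xs\<bar> \<le> n * B" if xs: "xs \<in> tuple_lists (carrier G) n" for xs
  proof -
    have "\<bar>prism (map d zs) f\<bar> \<le> n * B" if zs: "set zs \<subseteq> set xs \<times> R" "map fst zs = xs" for zs
    proof -
      have "length zs = n"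
        using zs xs by (auto simp: tuple_lists_def)
      then show ?thesis
        using prism_bound[of "carrier G" "map d zs" f B] bound dc[OF zs(1)] xs
        by (auto simp: tuple_lists_def)
    qed
    then show ?thesis unfolding e_def using label_mean_bound[OF R] by (metis abs_minus_cancel)
  qed
  have e_inv: "e (map ((\<otimes>) a) xs) = e xs" if xs: "xs \<in> tuple_lists (carrier G) n" and a: "a \<in> carrier G" for xs a
  proof -
    have "label_mean R (map ((\<otimes>) a) xs) (\<lambda>zs. prism (map d zs) f) =
      label_mean R xs (\<lambda>zs. prism (map d (map (map_prod ((\<otimes>) a) id) zs)) f)"
      by (rule label_mean_map)
    also have "\<dots> = label_mean R xs (\<lambda>zs. prism (map d zs) f)"
    proof (rule label_mean_cong)
      fix zs assume zs: "set zs \<subseteq> set xs \<times> R" "map fst zs = xs"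
      then have len: "length zs = n" using xs by (auto simp: tuple_lists_def)
      have "map d (map (map_prod ((\<otimes>) a) id) zs) = map (map_prod ((\<otimes>) a) ((\<otimes>) a)) (map d zs)"
        using zs xs a cc by (fastforce simp: d_def tuple_lists_def m_assoc)
      then have "prism (map d (map (map_prod ((\<otimes>) a) id) zs)) f
          = prism (map d zs) (\<lambda>ys. f (map ((\<otimes>) a) ys))"
        by (simp add: prism_map del: map_map)
      also have "\<dots> = prism (map d zs) f"
        using dc[OF zs(1)] xs len
        by (intro prism_cong[of "carrier G"]) (auto simp: tuple_lists_def intro!: invar[OF a])
      finally show "prism (map d (map (map_prod ((\<otimes>) a) id) zs)) f = prism (map d zs) f" .
    qed
    finally show ?thesis by (simp add: e_def)
  qed
  have homotopy: "f xs - cobd xs e = label_mean R xs (\<lambda>zs. f (map snd (map d zs)))"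
    if xs: "xs \<in> tuple_lists (carrier G) (Suc n)" for xs
  proof -
    have "- cobd xs e = cobd xs (\<lambda>ys. label_mean R ys (\<lambda>zs. prism (map d zs) f))"
      unfolding e_def by (simp add: cobd_uminus)
    also have "\<dots> = label_mean R xs (\<lambda>zs. cobd zs (\<lambda>us. prism (map d us) f))"
      by (simp add: label_mean_cobd[OF R])
    also have "\<dots> = label_mean R xs (\<lambda>zs. f (map snd (map d zs)) - f xs)"
    proof (rule label_mean_cong)
      fix zs assume zs: "set zs \<subseteq> set xs \<times> R" "map fst zs = xs"
      then have len: "length zs = Suc n" using xs by (auto simp: tuple_lists_def)
      have zero: "prism us (\<lambda>_. 0) = 0" for us :: "('a \<times> 'a) list"
        using prism_diff[of us "\<lambda>_. 0" "\<lambda>_. 0"] by simp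
      have "prism (map d zs) (\<lambda>ys. cobd ys f) = prism (map d zs) (\<lambda>_. 0)"
        using dc[OF zs(1)] xs len
        by (intro prism_cong[of "carrier G"]) (auto simp: tuple_lists_def intro!: cocycle)
      moreover have "map fst (map d zs) = xs"
        using zs by (auto simp: d_def case_prod_unfold comp_def)
      ultimately show "cobd zs (\<lambda>us. prism (map d us) f) = f (map snd (map d zs)) - f xs"
        using prism_homotopy[of "map d zs" f] zero cobd_map[of zs "\<lambda>us. prism us f" d] by simp
    qed
    also have "\<dots> = label_mean R xs (\<lambda>zs. f (map snd (map d zs))) - f xs"
      by (simp add: label_mean_diff label_mean_const[OF R])
    finally show ?thesis by simp
  qed
  have mean: "label_mean R xs (\<lambda>zs. f (map snd (map d zs))) = (\<Sum>w\<in>W. F (res j w xs)) / card W"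
    if xs: "xs \<in> T" for xs
  proof -
    have len: "length xs = Suc n" "set xs \<subseteq> S" using xs by (auto simp: T_def tuple_lists_def)
    have "f (map snd (map d (zip xs w))) = F (res j w xs)" if w: "w \<in> W" for w
    proof -
      have w': "length w = Suc n" "set w \<subseteq> R" using w by (auto simp: W_def tuple_lists_def)
      have xw: "x \<in> S" "y \<in> R" if "(x, y) \<in> set (zip xs w)" for x y
        using that w' len by (auto dest: set_zip_leftD set_zip_rightD)
      let ?l = "map snd (map d (zip xs w))"
      have l: "?l \<in> tuple_lists (carrier G) (Suc n)"
      proof -
        have "x \<otimes> c y \<in> carrier G" if "(x, y) \<in> set (zip xs w)" for x y
          using xw[OF that] cc S by auto
        then show ?thesis using w' len by (auto simp: tuple_lists_def d_def)
      qed
      have "map ((\<otimes>) (g j)) ?l = map (\<lambda>(x, y). prod_conj g (y(j := x)) N) (zip xs w)"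
      proof (simp, intro ballI, clarify)
        fix x y assume "(x, y) \<in> set (zip xs w)"
        then have x: "x \<in> S" and y: "y \<in> R" using xw by auto
        have p: "prod_conj g (y(j := \<one>)) N \<in> carrier G" using pc[OF Rupd[OF y j \<open>\<one> \<in> S\<close>]] .
        have xG: "x \<in> carrier G" using x S by auto
        have "prod_conj g (y(j := x)) N = conj_by (g j) x \<otimes> prod_conj g (y(j := \<one>)) N"
          using prod_conj_upd[OF g S(2,3) j order.refl RS[OF y] x] .
        then show "g j \<otimes> snd (d (x, y)) = prod_conj g (y(j := x)) N"
          using p xG gc[OF j] by (simp add: d_def c_def conj_by_def m_assoc)
      qed
      also have "\<dots> = map (\<lambda>y. prod_conj g y N) (res j w xs)"
        using w' len by (auto simp: res_def intro!: nth_equalityI)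
      finally show ?thesis
        using invar[OF gc[OF j] l] by (simp add: F_def)
    qed
    moreover have "card W = card R ^ length xs"
      using R len by (simp add: W_def tuple_lists_def card_lists_length_eq)
    ultimately show ?thesis
      using len by (simp add: label_mean_def W_def tuple_lists_def)
  qed
  have "card T = card S ^ Suc n"
    unfolding T_def tuple_lists_def by (rule card_lists_length_eq[OF S(1)])
  moreover have "f xs - cobd xs e = (\<Sum>w\<in>W. F (res j w xs)) / card W" if xs: "xs \<in> T" for xs
  proof -
    have "xs \<in> tuple_lists (carrier G) (Suc n)" using xs S by (auto simp: T_def tuple_lists_def)
    from trans[OF homotopy[OF this] mean[OF xs]] show ?thesis .
  qed
  ultimately have "(f xs - cobd xs e - m)\<^sup>2 \<le> real (card S ^ Suc n) * B\<^sup>2 / N" if "xs \<in> T" for xs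
    using near[OF that] that by presburger
  moreover have "invariant_on_tuples n e"
    using e_inv by (simp add: invariant_on_tuples_def)
  ultimately show ?thesis
    using e_bound m unfolding T_def by blast
qed

text \<open>The constant \<open>m\<close> is the coboundary of a constant if \<open>n\<close> is even.  If \<open>n\<close> is odd, the coboundary
  of the constant \<open>m\<close> is \<open>m\<close> itself, while that of \<open>f - \<delta>e\<close> vanishes; so \<open>m\<close> is as small as the error.\<close>

lemma approximate_primitive:
  fixes B \<epsilon> :: real
  assumes G: "commuting_conjugates G" and S0: "finite S\<^sub>0" "S\<^sub>0 \<subseteq> carrier G" and \<epsilon>: "\<epsilon> > 0"
    and f: "invariant_cocycle (Suc n) B f"
  shows "\<exists>e. (\<forall>xs\<in>tuple_lists (carrier G) n. \<bar>e xs\<bar> \<le> Suc n * B) \<and>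
    invariant_on_tuples n e \<and>
    (\<forall>xs\<in>tuple_lists S\<^sub>0 (Suc n). \<bar>f xs - cobd xs e\<bar> \<le> \<epsilon>)"
proof -
  have cocycle: "\<And>xs. xs \<in> tuple_lists (carrier G) (Suc (Suc n)) \<Longrightarrow> cobd xs f = 0"
    using f by (auto simp: invariant_cocycle_def)
  \<comment> \<open>The unit is adjoined so that one factor of a product of conjugates can be replaced by the unit.\<close>
  define S where "S = insert \<one> S\<^sub>0"
  have S: "finite S" "S \<subseteq> carrier G" "\<one> \<in> S" using S0 by (auto simp: S_def)
  \<comment> \<open>For odd \<open>n\<close> the constant costs a further \<open>n + 2\<close> times the error.\<close>
  define \<eta> where "\<eta> = \<epsilon> / (n + 3)"
  have \<eta>: "\<eta> > 0" using \<epsilon> by (simp add: \<eta>_def)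
  obtain N :: nat where N: "real (card S ^ Suc n) * B\<^sup>2 / \<eta>\<^sup>2 < N"
    using reals_Archimedean2 by blast
  moreover have "0 \<le> real (card S ^ Suc n) * B\<^sup>2 / \<eta>\<^sup>2" by simp
  ultimately have N0: "N > 0" by (metis of_nat_0_less_iff order.strict_trans1)
  obtain g where g: "commuting_family N g S"
    using ex_commuting_family[OF G S(1,2)] by blast
  obtain e m where e_bound: "\<And>xs. xs \<in> tuple_lists (carrier G) n \<Longrightarrow> \<bar>e xs\<bar> \<le> n * B"
    and e_inv: "invariant_on_tuples n e"
    and m: "\<bar>m\<bar> \<le> B"
    and near2: "\<And>xs. xs \<in> tuple_lists S (Suc n) \<Longrightarrow>
      (f xs - cobd xs e - m)\<^sup>2 \<le> real (card S ^ Suc n) * B\<^sup>2 / N"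
    using almost_constant_up_to_coboundary[OF S g N0 f] by blast
  have near: "\<bar>f xs - cobd xs e - m\<bar> \<le> \<eta>" if "xs \<in> tuple_lists S (Suc n)" for xs
  proof -
    have "real (card S ^ Suc n) * B\<^sup>2 / N \<le> \<eta>\<^sup>2"
      using N N0 \<eta> by (simp add: field_simps)
    then have "(f xs - cobd xs e - m)\<^sup>2 \<le> \<eta>\<^sup>2" using near2[OF that] by linarith
    then show ?thesis using \<eta> by (metis abs_le_square_iff abs_of_pos)
  qed
  have sub: "xs \<in> tuple_lists S (Suc n)" if "xs \<in> tuple_lists S\<^sub>0 (Suc n)" for xs
    using that by (auto simp: tuple_lists_def S_def)
  have B0: "0 \<le> B" using m by linarith
  show ?thesis
  proof (cases "even n")
    case True
    have "cobd xs (\<lambda>ys. e ys + m) = cobd xs e + m" if "length xs = Suc n" for xs :: "'a list"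
      using True that by (simp add: cobd_add cobd_const)
    then have "\<bar>f xs - cobd xs (\<lambda>ys. e ys + m)\<bar> \<le> \<epsilon>" if xs: "xs \<in> tuple_lists S\<^sub>0 (Suc n)" for xs
    proof -
      have "\<eta> \<le> \<epsilon>" using \<epsilon> by (simp add: \<eta>_def field_simps)
      then show ?thesis
        using near[OF sub[OF xs]] xs \<open>\<And>xs. length xs = Suc n \<Longrightarrow> cobd xs (\<lambda>ys. e ys + m) = cobd xs e + m\<close>
        by (auto simp: tuple_lists_def)
    qed
    moreover have "\<bar>e xs + m\<bar> \<le> Suc n * B" if "xs \<in> tuple_lists (carrier G) n" for xs
      using e_bound[OF that] m by (simp add: algebra_simps)
    ultimately show ?thesis
      using e_inv by (intro exI[of _ "\<lambda>ys. e ys + m"]) (auto simp: invariant_on_tuples_def)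
  next
    case False
    define us where "us = replicate (n + 2) \<one>"
    have us: "us \<in> tuple_lists (carrier G) (Suc (Suc n))" "set us \<subseteq> S" "length us = n + 2"
      using S by (auto simp: us_def tuple_lists_def)
    have "cobd us (\<lambda>ys. f ys - cobd ys e - m) = - m"
      using False us cocycle[OF us(1)] by (simp add: cobd_diff cobd_cobd cobd_const)
    moreover have "\<bar>cobd us (\<lambda>ys. f ys - cobd ys e - m)\<bar> \<le> length us * \<eta>"
      using us near by (intro cobd_bound[of S]) (auto simp: tuple_lists_def)
    ultimately have m': "\<bar>m\<bar> \<le> (n + 2) * \<eta>" using us by simp
    have "\<bar>f xs - cobd xs e\<bar> \<le> \<epsilon>" if xs: "xs \<in> tuple_lists S\<^sub>0 (Suc n)" for xs
    proof -
      have "\<bar>f xs - cobd xs e\<bar> \<le> \<eta> + (n + 2) * \<eta>"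
        using near[OF sub[OF xs]] m' by linarith
      also have "\<dots> = (n + 3) * \<eta>" by (simp add: algebra_simps)
      also have "\<dots> = \<epsilon>" by (simp add: \<eta>_def)
      finally show ?thesis .
    qed
    moreover have "\<bar>e xs\<bar> \<le> Suc n * B" if "xs \<in> tuple_lists (carrier G) n" for xs
      using e_bound[OF that] B0 by (simp add: algebra_simps)
    ultimately show ?thesis using e_inv by blast
  qed
qed

lemma continuous_on_cobd: "continuous_on UNIV (\<lambda>e. cobd xs e)"
  unfolding cobd_eq_sum by (intro continuous_intros) auto

text \<open>The approximate primitives for all finite sets \<open>S\<close> and errors \<open>1/(k+1)\<close> lie in one cube, compact
  in the topology of pointwise convergence, and the conditions on them are closed and directed.\<close>

lemma bounded_primitive:
  fixes B :: real
  assumes G: "commuting_conjugates G"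
    and f: "invariant_cocycle (Suc n) B f"
  obtains e where "\<And>xs. \<bar>e xs\<bar> \<le> Suc n * B"
    and "invariant_on_tuples n e"
    and "\<And>xs. xs \<in> tuple_lists (carrier G) (Suc n) \<Longrightarrow> cobd xs e = f xs"
proof -
  define C where "C = Suc n * B"
  define box :: "('a list \<Rightarrow> real) set" where "box = PiE UNIV (\<lambda>_. {-C..C})"
  define J where "J = {S. finite S \<and> S \<subseteq> carrier G} \<times> (UNIV :: nat set)"
  define D where "D = (\<lambda>(S, k::nat). {e.
    invariant_on_tuples n e \<and>
    (\<forall>xs\<in>tuple_lists S (Suc n). \<bar>f xs - cobd xs e\<bar> \<le> 1 / Suc k)})"
  have "replicate (Suc n) \<one> \<in> tuple_lists (carrier G) (Suc n)" by (auto simp: tuple_lists_def)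
  then have "\<bar>f (replicate (Suc n) \<one>)\<bar> \<le> B" using f unfolding invariant_cocycle_def by blast
  then have "0 \<le> B" by linarith
  then have C0: "0 \<le> C" by (simp add: C_def)
  have "compactin (product_topology (\<lambda>_. euclidean) UNIV) box"
    unfolding box_def compactin_PiE by (auto simp: compactin_euclidean_iff)
  then have box: "compact box"
    by (simp add: euclidean_product_topology compactin_euclidean_iff)
  have closed: "closed (D p)" for p
    unfolding D_def case_prod_unfold Ball_def invariant_on_tuples_def
    by (intro closed_Collect_conj closed_Collect_all closed_Collect_imp closed_Collect_eq
        closed_Collect_le open_Collect_const continuous_intros continuous_on_cobd
        continuous_on_product_coordinates)
  have fip: "box \<inter> \<Inter>(D ` J') \<noteq> {}" if J': "finite J'" "J' \<subseteq> J" for J'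
  proof -
    define S where "S = \<Union>(fst ` J')"
    define k where "k = Max (insert 0 (snd ` J'))"
    have S: "finite S" "S \<subseteq> carrier G" using J' by (fastforce simp: S_def J_def)+
    have "0 < 1 / real (Suc k)" by simp
    from approximate_primitive[OF G S this f]
    obtain e where e_bound: "\<And>xs. xs \<in> tuple_lists (carrier G) n \<Longrightarrow> \<bar>e xs\<bar> \<le> C"
      and e_inv: "invariant_on_tuples n e"
      and near: "\<And>xs. xs \<in> tuple_lists S (Suc n) \<Longrightarrow> \<bar>f xs - cobd xs e\<bar> \<le> 1 / Suc k"
      unfolding C_def by blast
    \<comment> \<open>The cube restricts all values, also on lists that are not tuples of the group.\<close>
    define e' where "e' = (\<lambda>xs. if xs \<in> tuple_lists (carrier G) n then e xs else 0)"
    have "\<bar>e' xs\<bar> \<le> C" for xs using e_bound C0 by (auto simp: e'_def)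
    then have "e' \<in> box" by (auto simp: box_def abs_le_iff) (metis minus_le_iff)
    moreover have "e' \<in> D p" if p: "p \<in> J'" for p
    proof -
      obtain S' k' where p': "p = (S', k')" by force
      have S': "S' \<subseteq> S" using p p' by (force simp: S_def)
      have "k' \<le> k" using p p' J' by (force simp: k_def intro!: Max_ge)
      then have k': "1 / real (Suc k) \<le> 1 / Suc k'" by (simp add: frac_le)
      have "\<bar>f xs - cobd xs e'\<bar> \<le> 1 / Suc k'" if xs: "xs \<in> tuple_lists S' (Suc n)" for xs
      proof -
        have "cobd xs e' = cobd xs e"
          using xs S S' by (intro cobd_cong[of "carrier G"]) (auto simp: e'_def tuple_lists_def)
        moreover have "xs \<in> tuple_lists S (Suc n)" using xs S' by (auto simp: tuple_lists_def)
        ultimately show ?thesis using near k' by fastforce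
      qed
      moreover have "e' (map ((\<otimes>) a) xs) = e' xs"
        if "a \<in> carrier G" "xs \<in> tuple_lists (carrier G) n" for a xs
      proof -
        have "map ((\<otimes>) a) xs \<in> tuple_lists (carrier G) n"
          using that by (auto simp: tuple_lists_def)
        then show ?thesis using that e_inv by (simp add: e'_def invariant_on_tuples_def)
      qed
      ultimately show ?thesis by (simp add: D_def p' invariant_on_tuples_def)
    qed
    ultimately show ?thesis by blast
  qed
  have "box \<inter> \<Inter>(D ` J) \<noteq> {}"
    by (rule compact_imp_fip_image[OF box closed fip])
  then obtain e where e: "e \<in> box" "\<And>p. p \<in> J \<Longrightarrow> e \<in> D p" by blast
  show thesis
  proof (rule that)
    show "\<bar>e xs\<bar> \<le> Suc n * B" for xs
      using e(1) by (auto simp: box_def C_def PiE_iff abs_le_iff minus_le_iff)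
    have "({}, 0) \<in> J" by (simp add: J_def)
    from e(2)[OF this] show "invariant_on_tuples n e" by (simp add: D_def)
    show "cobd xs e = f xs" if xs: "xs \<in> tuple_lists (carrier G) (Suc n)" for xs
    proof -
      have "\<bar>f xs - cobd xs e\<bar> \<le> 1 / Suc k" for k
      proof -
        have "(set xs, k) \<in> J" using xs by (auto simp: J_def tuple_lists_def)
        from e(2)[OF this] show ?thesis using xs by (auto simp: D_def tuple_lists_def)
      qed
      then have "\<bar>f xs - cobd xs e\<bar> \<le> 0"
        by (intro LIMSEQ_le_const[OF LIMSEQ_Suc[OF lim_1_over_n]]) auto
      then show ?thesis by simp
    qed
  qed
qed

end

section \<open>Vanishing of bounded cohomology\<close>

lemma (in group) tuples_eq_tuple_lists: "tuples G n = tuple_lists (carrier G) (Suc n)"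
  by (auto simp: tuples_def tuple_lists_def)

lemma coboundary_eq_cobd: "coboundary G n f = (\<lambda>xs\<in>tuples G (Suc n). cobd xs f)"
  unfolding coboundary_def
  by (intro restrict_ext)
    (auto simp: cobd_eq_sum tuples_def lessThan_Suc_atMost intro!: sum.cong)

context group
begin

lemma carrier_invariant_cochain_group:
  "f \<in> carrier (invariant_cochain_group G n) \<longleftrightarrow>
    f \<in> extensional (tuples G n) \<and> (\<exists>B. \<forall>xs\<in>tuples G n. \<bar>f xs\<bar> \<le> B) \<and>
    invariant_on_tuples (Suc n) f"
proof -
  have "(\<forall>g\<in>carrier G. cochain_action G n g f = f) \<longleftrightarrow> invariant_on_tuples (Suc n) f"
    if f: "f \<in> extensional (tuples G n)"
  proof
    assume *: "\<forall>g\<in>carrier G. cochain_action G n g f = f"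
    show "invariant_on_tuples (Suc n) f"
      unfolding invariant_on_tuples_def
    proof (intro ballI)
      fix a xs assume a: "a \<in> carrier G" and xs: "xs \<in> tuple_lists (carrier G) (Suc n)"
      have "f xs = cochain_action G n (inv a) f xs" using * a by simp
      then show "f (map ((\<otimes>) a) xs) = f xs"
        using a xs by (simp add: cochain_action_def tuples_eq_tuple_lists)
    qed
  next
    assume *: "invariant_on_tuples (Suc n) f"
    show "\<forall>g\<in>carrier G. cochain_action G n g f = f"
    proof (intro ballI extensionalityI[where A = "tuples G n"])
      fix g xs assume "g \<in> carrier G" "xs \<in> tuples G n"
      then show "cochain_action G n g f xs = f xs"
        using * by (simp add: cochain_action_def invariant_on_tuples_def tuples_eq_tuple_lists)
    qed (use f in \<open>auto simp: cochain_action_def\<close>)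
  qed
  then show ?thesis
    by (auto simp: invariant_cochain_group_def bounded_cochains_def)
qed

lemma map_mult_tuples: "a \<in> carrier G \<Longrightarrow> xs \<in> tuples G n \<Longrightarrow> map ((\<otimes>) a) xs \<in> tuples G n"
  by (auto simp: tuples_def)

lemma comm_group_invariant_cochain_group: "comm_group (invariant_cochain_group G n)"
proof (rule comm_groupI)
  let ?C = "invariant_cochain_group G n"
  have add: "(x \<otimes>\<^bsub>?C\<^esub> y) = (\<lambda>xs\<in>tuples G n. x xs + y xs)" for x y
    by (simp add: invariant_cochain_group_def)
  have one: "\<one>\<^bsub>?C\<^esub> = (\<lambda>xs\<in>tuples G n. 0)"
    by (simp add: invariant_cochain_group_def)
  show "x \<otimes>\<^bsub>?C\<^esub> y \<in> carrier ?C" if x: "x \<in> carrier ?C" and y: "y \<in> carrier ?C" for x y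
  proof -
    obtain B B' where B: "\<forall>xs\<in>tuples G n. \<bar>x xs\<bar> \<le> B" "\<forall>xs\<in>tuples G n. \<bar>y xs\<bar> \<le> B'"
      using x y by (auto simp: carrier_invariant_cochain_group)
    then have "\<forall>xs\<in>tuples G n. \<bar>x xs + y xs\<bar> \<le> B + B'" by fastforce
    then show ?thesis
      using x y
      by (auto simp: carrier_invariant_cochain_group add invariant_on_tuples_def map_mult_tuples
          simp flip: tuples_eq_tuple_lists)
  qed
  show "\<one>\<^bsub>?C\<^esub> \<in> carrier ?C"
    by (auto simp: carrier_invariant_cochain_group one invariant_on_tuples_def map_mult_tuples
          simp flip: tuples_eq_tuple_lists)
  show "\<one>\<^bsub>?C\<^esub> \<otimes>\<^bsub>?C\<^esub> x = x" if "x \<in> carrier ?C" for x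
    using that by (auto simp: carrier_invariant_cochain_group add one extensional_def)
  show "\<exists>y\<in>carrier ?C. y \<otimes>\<^bsub>?C\<^esub> x = \<one>\<^bsub>?C\<^esub>" if x: "x \<in> carrier ?C" for x
    using x
    by (intro bexI[of _ "\<lambda>xs\<in>tuples G n. - x xs"])
      (auto simp: carrier_invariant_cochain_group add one invariant_on_tuples_def map_mult_tuples
          simp flip: tuples_eq_tuple_lists)
qed (auto simp: invariant_cochain_group_def algebra_simps intro!: restrict_ext)

lemma del_in_tuples:
  "xs \<in> tuples G (Suc n) \<Longrightarrow> set ys \<subseteq> carrier G \<Longrightarrow> Suc (length ys) = length xs \<Longrightarrow> ys \<in> tuples G n"
  by (auto simp: tuples_def)

lemma coboundary_closed:
  assumes f: "f \<in> carrier (invariant_cochain_group G n)"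
  shows "coboundary G n f \<in> carrier (invariant_cochain_group G (Suc n))"
proof -
  obtain B where B: "\<forall>xs\<in>tuples G n. \<bar>f xs\<bar> \<le> B" and inv: "invariant_on_tuples (Suc n) f"
    using f by (auto simp: carrier_invariant_cochain_group)
  have "\<bar>cobd xs f\<bar> \<le> (n + 2) * B" if xs: "xs \<in> tuples G (Suc n)" for xs
  proof -
    have "\<bar>cobd xs f\<bar> \<le> length xs * B"
      using B xs del_in_tuples[OF xs] by (intro cobd_bound[of "carrier G"]) (auto simp: tuples_def)
    then show ?thesis using xs by (simp add: tuples_def)
  qed
  moreover have "cobd (map ((\<otimes>) a) xs) f = cobd xs f"
    if a: "a \<in> carrier G" and xs: "xs \<in> tuples G (Suc n)" for a xs
  proof -
    have "cobd (map ((\<otimes>) a) xs) f = cobd xs (\<lambda>ys. f (map ((\<otimes>) a) ys))"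
      by (rule cobd_map[symmetric])
    also have "\<dots> = cobd xs f"
      using inv a xs del_in_tuples[OF xs]
      by (intro cobd_cong[of "carrier G"])
        (auto simp: invariant_on_tuples_def tuples_def simp flip: tuples_eq_tuple_lists)
    finally show ?thesis .
  qed
  ultimately show ?thesis
    by (auto simp: carrier_invariant_cochain_group coboundary_eq_cobd invariant_on_tuples_def
        map_mult_tuples simp flip: tuples_eq_tuple_lists)
qed

lemma coboundary_coboundary:
  "coboundary G (Suc n) (coboundary G n f) = \<one>\<^bsub>invariant_cochain_group G (Suc (Suc n))\<^esub>"
proof -
  have "cobd xs (coboundary G n f) = 0" if xs: "xs \<in> tuples G (Suc (Suc n))" for xs
  proof -
    have "cobd xs (coboundary G n f) = cobd xs (\<lambda>ys. cobd ys f)"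
      using xs del_in_tuples[OF xs]
      by (intro cobd_cong[of "carrier G"]) (auto simp: coboundary_eq_cobd tuples_def)
    then show ?thesis by (simp add: cobd_cobd)
  qed
  then show ?thesis
    by (subst coboundary_eq_cobd) (auto simp: invariant_cochain_group_def intro!: restrict_ext)
qed

lemma coboundary_hom:
  "coboundary G n \<in> hom (invariant_cochain_group G n) (invariant_cochain_group G (Suc n))"
proof (rule homI)
  fix f g
  have "cobd xs (\<lambda>ys\<in>tuples G n. f ys + g ys) = cobd xs f + cobd xs g" if xs: "xs \<in> tuples G (Suc n)" for xs
  proof -
    have "cobd xs (\<lambda>ys\<in>tuples G n. f ys + g ys) = cobd xs (\<lambda>ys. f ys + g ys)"
      using xs del_in_tuples[OF xs] by (intro cobd_cong[of "carrier G"]) (auto simp: tuples_def)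
    then show ?thesis by (simp add: cobd_add)
  qed
  then show "coboundary G n (f \<otimes>\<^bsub>invariant_cochain_group G n\<^esub> g) =
      coboundary G n f \<otimes>\<^bsub>invariant_cochain_group G (Suc n)\<^esub> coboundary G n g"
    unfolding coboundary_eq_cobd
    by (auto simp: invariant_cochain_group_def intro!: restrict_ext)
qed (rule coboundary_closed)

text \<open>The primitive given by \<open>bounded_primitive\<close> is bounded and invariant, hence a bounded cochain of
  the invariant complex after restriction to tuples.\<close>

lemma bounded_coboundaries_eq_cocycles:
  assumes G: "commuting_conjugates G"
  shows "bounded_coboundaries G (Suc n) = bounded_cocycles G (Suc n)"
proof
  show "bounded_coboundaries G (Suc n) \<subseteq> bounded_cocycles G (Suc n)"
    by (auto simp: bounded_coboundaries_def bounded_cocycles_def kernel_def coboundary_closed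
        coboundary_coboundary)
  show "bounded_cocycles G (Suc n) \<subseteq> bounded_coboundaries G (Suc n)"
  proof
    fix f assume f: "f \<in> bounded_cocycles G (Suc n)"
    then have fC: "f \<in> carrier (invariant_cochain_group G (Suc n))"
      and zero: "coboundary G (Suc n) f = \<one>\<^bsub>invariant_cochain_group G (Suc (Suc n))\<^esub>"
      by (auto simp: bounded_cocycles_def kernel_def)
    have "cobd xs f = 0" if "xs \<in> tuples G (Suc (Suc n))" for xs
      using fun_cong[OF zero, of xs] that
      by (simp add: coboundary_eq_cobd invariant_cochain_group_def)
    moreover obtain B where "\<forall>xs\<in>tuples G (Suc n). \<bar>f xs\<bar> \<le> B"
      and "invariant_on_tuples (Suc (Suc n)) f"
      using fC by (auto simp: carrier_invariant_cochain_group)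
    ultimately have "invariant_cocycle (Suc (Suc n)) B f"
      by (auto simp: invariant_cocycle_def simp flip: tuples_eq_tuple_lists)
    then obtain e where e: "\<And>xs. \<bar>e xs\<bar> \<le> Suc (Suc n) * B" "invariant_on_tuples (Suc n) e"
      "\<And>xs. xs \<in> tuple_lists (carrier G) (Suc (Suc n)) \<Longrightarrow> cobd xs e = f xs"
      using bounded_primitive[OF G] by metis
    define e' where "e' = restrict e (tuples G n)"
    have "e' \<in> carrier (invariant_cochain_group G n)"
      using e(1,2)
      by (auto simp: e'_def carrier_invariant_cochain_group invariant_on_tuples_def map_mult_tuples
          simp flip: tuples_eq_tuple_lists)
    moreover have "coboundary G n e' = f"
    proof (rule extensionalityI[where A = "tuples G (Suc n)"])
      fix xs assume xs: "xs \<in> tuples G (Suc n)"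
      have "cobd xs e' = cobd xs e"
        using xs del_in_tuples[OF xs]
        by (intro cobd_cong[of "carrier G"]) (auto simp: e'_def tuples_def)
      then show "coboundary G n e' xs = f xs"
        using xs e(3) by (simp add: coboundary_eq_cobd tuples_eq_tuple_lists)
    qed (use fC in \<open>auto simp: coboundary_eq_cobd carrier_invariant_cochain_group\<close>)
    ultimately show "f \<in> bounded_coboundaries G (Suc n)"
      by (auto simp: bounded_coboundaries_def)
  qed
qed

lemma trivial_group_Mod_carrier: "trivial_group (G Mod carrier G)"
proof -
  have "carrier G \<lhd> G"
    by (simp add: normalI subgroup_self coset_join2 coset_join3)
  then interpret N: group "G Mod carrier G" by (rule normal.factorgroup_is_group)
  have "carrier (G Mod carrier G) = {carrier G}"
    unfolding FactGroup_def RCOSETS_def using coset_join2[OF _ subgroup_self] by auto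
  then show ?thesis by (simp add: N.trivial_group)
qed

theorem commuting_conjugates_imp_boundedly_acyclic:
  assumes G: "commuting_conjugates G"
  shows "boundedly_acyclic G"
  unfolding boundedly_acyclic_def
proof (intro conjI allI impI)
  show "group G" by (rule is_group)
  fix n :: nat assume "n \<ge> 1"
  then obtain m where n: "n = Suc m" by (cases n) auto
  let ?C = "invariant_cochain_group G"
  have C: "group (?C k)" for k
    using comm_group_invariant_cochain_group by (rule comm_group.axioms(2))
  have "subgroup (bounded_cocycles G n) (?C n)"
    unfolding bounded_cocycles_def
    using group_hom.subgroup_kernel[OF group_hom.intro[OF C C group_hom_axioms.intro[OF coboundary_hom]]] .
  then have "group ((?C n)\<lparr>carrier := bounded_cocycles G n\<rparr>)"
    using C by (rule subgroup.subgroup_is_group)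
  from group.trivial_group_Mod_carrier[OF this]
  show "trivial_group (bounded_cohomology G n)"
    by (simp add: bounded_cohomology_def n bounded_coboundaries_eq_cocycles[OF G])
qed

end

section \<open>Cantor sets are homeomorphic\<close>

abbreviation clopen_in :: "'a::topological_space set \<Rightarrow> 'a set \<Rightarrow> bool" where
  "clopen_in K A \<equiv> openin (top_of_set K) A \<and> closedin (top_of_set K) A"

lemma clopen_in_Un: "clopen_in K A \<Longrightarrow> clopen_in K B \<Longrightarrow> clopen_in K (A \<union> B)"
  by auto

lemma clopen_in_Diff: "clopen_in K A \<Longrightarrow> clopen_in K B \<Longrightarrow> clopen_in K (A - B)"
  by (auto intro: openin_diff closedin_diff)

lemma clopen_in_trans: "clopen_in A B \<Longrightarrow> clopen_in K A \<Longrightarrow> clopen_in K B"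
  using openin_trans closedin_trans by blast

lemma clopen_in_self: "clopen_in K K" by simp

lemma clopen_in_subset: "clopen_in K A \<Longrightarrow> A \<subseteq> K"
  by (auto dest: openin_imp_subset)

lemma totally_disconnected_iff:
  "totally_disconnected S \<longleftrightarrow>
    (\<forall>C x y. C \<subseteq> S \<longrightarrow> connected C \<longrightarrow> x \<in> C \<longrightarrow> y \<in> C \<longrightarrow> x = y)"
proof
  assume td: "totally_disconnected S"
  show "\<forall>C x y. C \<subseteq> S \<longrightarrow> connected C \<longrightarrow> x \<in> C \<longrightarrow> y \<in> C \<longrightarrow> x = y"
  proof (intro allI impI)
    fix C x y assume C: "C \<subseteq> S" "connected C" "x \<in> C" "y \<in> C"
    then have "C \<subseteq> connected_component_set S x" by (intro connected_component_maximal)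
    moreover have "connected_component_set S x \<in> components S" using C by (intro componentsI) auto
    then obtain w where "connected_component_set S x = {w}"
      using td unfolding totally_disconnected_def by blast
    ultimately show "x = y" using C by auto
  qed
next
  assume *: "\<forall>C x y. C \<subseteq> S \<longrightarrow> connected C \<longrightarrow> x \<in> C \<longrightarrow> y \<in> C \<longrightarrow> x = y"
  show "totally_disconnected S"
    unfolding totally_disconnected_def
  proof
    fix C assume C: "C \<in> components S"
    then obtain x where "x \<in> C" using in_components_nonempty by blast
    moreover have "C \<subseteq> S" "connected C"
      using C in_components_subset in_components_connected by blast+
    ultimately have "C = {x}" using * by blast
    then show "\<exists>x. C = {x}" by blast
  qed
qed

text \<open>In a compact Hausdorff space, components are quasi-components.\<close>

lemma clopen_separation:
  fixes K :: "'a::metric_space set"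
  assumes K: "compact K" "totally_disconnected K" and xy: "x \<in> K" "y \<in> K" "x \<noteq> y"
  obtains A where "clopen_in K A" "x \<in> A" "y \<notin> A"
proof -
  have "quasi_component_of (top_of_set K) x = connected_component_of (top_of_set K) x"
    by (rule quasi_eq_connected_component_of)
      (simp add: K compact_space_subtopology Hausdorff_space_subtopology)
  moreover have "\<not> connected_component_of (top_of_set K) x y"
    using K(2) xy
    by (auto simp: connected_component_of_def connectedin_subtopology totally_disconnected_iff)
  ultimately have "\<not> quasi_component_of (top_of_set K) x y" by simp
  then show ?thesis
    using xy that by (auto simp: quasi_component_of)
qed

text \<open>The complement of \<open>U\<close> is compact, so finitely many of the clopen sets that separate \<open>x\<close> from its
  points have their intersection in \<open>U\<close>.\<close>

lemma clopen_neighbourhood: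
  fixes K :: "'a::metric_space set"
  assumes K: "compact K" "totally_disconnected K" and U: "openin (top_of_set K) U" "x \<in> U"
  obtains A where "clopen_in K A" "x \<in> A" "A \<subseteq> U"
proof -
  define \<T> where "\<T> = {T. clopen_in K T \<and> x \<in> T}"
  have xK: "x \<in> K" using U openin_imp_subset by blast
  have "closedin (top_of_set K) (K - U)" using U by (simp add: closedin_diff)
  then have cpt: "compact (K - U)" using K closedin_compact by blast
  have "\<exists>F. finite F \<and> F \<subseteq> \<T> \<and> (K - U) \<inter> \<Inter>F = {}"
  proof (rule ccontr)
    assume none: "\<not> ?thesis"
    have "(K - U) \<inter> \<Inter>\<T> \<noteq> {}"
    proof (rule compact_imp_fip[OF cpt])
      show "closed T" if "T \<in> \<T>" for T
        using that K closedin_compact compact_imp_closed by (auto simp: \<T>_def)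
    qed (use none in blast)
    then obtain y where y: "y \<in> K - U" "y \<in> \<Inter>\<T>" by blast
    have "x \<noteq> y" using y U by blast
    then obtain A where "clopen_in K A" "x \<in> A" "y \<notin> A"
      using clopen_separation[OF K xK] y by blast
    then show False using y by (auto simp: \<T>_def)
  qed
  then obtain F where F: "finite F" "F \<subseteq> \<T>" "(K - U) \<inter> \<Inter>F = {}" by blast
  have "clopen_in K (\<Inter>(insert K F))"
    using F by (intro conjI openin_Inter closedin_Inter) (auto simp: \<T>_def)
  moreover have "x \<in> \<Inter>(insert K F)" using F xK by (auto simp: \<T>_def)
  moreover have "\<Inter>(insert K F) \<subseteq> U" using F by auto
  ultimately show ?thesis by (rule that)
qed

lemma cantor_set_clopen:
  assumes K: "cantor_set K" and A: "clopen_in K A"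
  shows "cantor_set A"
proof -
  have "compact A" using K A closedin_compact by (auto simp: cantor_set_def)
  moreover have "totally_disconnected A"
    using K clopen_in_subset[OF A] unfolding cantor_set_def totally_disconnected_iff
    by (meson order.trans)
  moreover have "x islimpt A" if x: "x \<in> A" for x
  proof -
    obtain V where V: "open V" "A = K \<inter> V" using A by (auto simp: openin_open)
    have "x islimpt K" using K x clopen_in_subset[OF A] by (auto simp: cantor_set_def)
    show ?thesis
    proof (rule islimptI)
      fix T assume "x \<in> T" "open T"
      then have "x \<in> T \<inter> V" "open (T \<inter> V)" using V x by auto
      then obtain y where "y \<in> K" "y \<in> T \<inter> V" "y \<noteq> x"
        using \<open>x islimpt K\<close> by (meson islimptE)
      then show "\<exists>y\<in>A. y \<in> T \<and> y \<noteq> x" using V by auto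
    qed
  qed
  ultimately show ?thesis by (simp add: cantor_set_def)
qed

lemma cantor_set_split:
  assumes K: "cantor_set K" and "K \<noteq> {}"
  obtains A where "clopen_in K A" "A \<noteq> {}" "K - A \<noteq> {}"
proof -
  obtain x where x: "x \<in> K" using \<open>K \<noteq> {}\<close> by blast
  then have "x islimpt K" using K by (simp add: cantor_set_def)
  then obtain y where y: "y \<in> K" "y \<noteq> x" by (meson UNIV_I islimptE open_UNIV)
  then obtain A where "clopen_in K A" "x \<in> A" "y \<notin> A"
    using clopen_separation[of K x y] K x by (auto simp: cantor_set_def)
  then show ?thesis using that y by blast
qed

text \<open>Finite covers by clopen sets of diameter less than \<open>1/(k+1)\<close>, for all \<open>k\<close>, are together countable
  and separate points.\<close>

lemma cantor_set_separating_sequence: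
  fixes K :: "'a::metric_space set"
  assumes K: "cantor_set K"
  shows "\<exists>U :: nat \<Rightarrow> 'a set. (\<forall>n. clopen_in K (U n)) \<and>
    (\<forall>x\<in>K. \<forall>y\<in>K. x \<noteq> y \<longrightarrow> (\<exists>n. x \<in> U n \<and> y \<notin> U n))"
proof -
  have cpt: "compact K" and td: "totally_disconnected K" using K by (auto simp: cantor_set_def)
  have "\<exists>\<C>. finite \<C> \<and> (\<forall>A\<in>\<C>. clopen_in K A \<and> (\<forall>x\<in>A. \<forall>y\<in>A. dist x y < e)) \<and> K \<subseteq> \<Union>\<C>"
    if e: "e > 0" for e :: real
  proof -
    define \<D> where "\<D> = {A. clopen_in K A \<and> (\<forall>x\<in>A. \<forall>y\<in>A. dist x y < e)}"
    have "K \<subseteq> \<Union>\<D>"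
    proof
      fix x assume x: "x \<in> K"
      have "openin (top_of_set K) (K \<inter> ball x (e / 2))" by (simp add: openin_open_Int)
      then obtain A where A: "clopen_in K A" "x \<in> A" "A \<subseteq> K \<inter> ball x (e / 2)"
        using clopen_neighbourhood[OF cpt td, of "K \<inter> ball x (e / 2)" x] x e by auto
      have "dist y z < e" if "y \<in> A" "z \<in> A" for y z
      proof -
        have "dist x y < e / 2" "dist x z < e / 2" using that A by auto
        then show ?thesis using dist_triangle_half_r by metis
      qed
      then show "x \<in> \<Union>\<D>" using A by (auto simp: \<D>_def)
    qed
    moreover have "\<forall>A\<in>\<D>. openin (top_of_set K) A" by (auto simp: \<D>_def)
    ultimately obtain \<C> where "\<C> \<subseteq> \<D>" "finite \<C>" "K \<subseteq> \<Union>\<C>"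
      using cpt unfolding compact_eq_openin_cover by meson
    then show ?thesis by (intro exI[of _ \<C>]) (auto simp: \<D>_def)
  qed
  then have "\<forall>k::nat. \<exists>\<C>. finite \<C> \<and>
      (\<forall>A\<in>\<C>. clopen_in K A \<and> (\<forall>x\<in>A. \<forall>y\<in>A. dist x y < 1 / Suc k)) \<and> K \<subseteq> \<Union>\<C>"
    by simp
  then obtain \<C> where \<C>: "\<And>k::nat. finite (\<C> k)" "\<And>k A. A \<in> \<C> k \<Longrightarrow> clopen_in K A"
    "\<And>k A x y. A \<in> \<C> k \<Longrightarrow> x \<in> A \<Longrightarrow> y \<in> A \<Longrightarrow> dist x y < 1 / Suc k" "\<And>k. K \<subseteq> \<Union>(\<C> k)"
    by metis
  define \<U> where "\<U> = insert K (\<Union>k. \<C> k)"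
  have "countable \<U>" "\<U> \<noteq> {}" using \<C>(1) by (auto simp: \<U>_def intro: countable_finite)
  then have ran: "range (from_nat_into \<U>) = \<U>" by (intro range_from_nat_into)
  show ?thesis
  proof (intro exI[of _ "from_nat_into \<U>"] conjI allI ballI impI)
    fix n
    have "from_nat_into \<U> n \<in> \<U>" using ran by blast
    then have "clopen_in K (from_nat_into \<U> n)" using \<C>(2) by (auto simp: \<U>_def)
    then show "openin (top_of_set K) (from_nat_into \<U> n)"
      and "closedin (top_of_set K) (from_nat_into \<U> n)" by auto
  next
    fix x y assume xy: "x \<in> K" "y \<in> K" "x \<noteq> y"
    then obtain k where k: "1 / Suc k < dist x y"
      using nat_approx_posE[of "dist x y"] by (metis zero_less_dist_iff)
    obtain A where A: "A \<in> \<C> k" "x \<in> A" using \<C>(4) xy by blast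
    then have "y \<notin> A" using \<C>(3)[OF A(1,2)] k by fastforce
    moreover have "A \<in> range (from_nat_into \<U>)" using A ran by (auto simp: \<U>_def)
    ultimately show "\<exists>n. x \<in> from_nat_into \<U> n \<and> y \<notin> from_nat_into \<U> n" using A by blast
  qed
qed

text \<open>A binary tree of clopen sets whose branches separate points.  A node is the list of the choices leading to
  it, with the latest choice in front.\<close>

definition cantor_scheme :: "'a::topological_space set \<Rightarrow> (bool list \<Rightarrow> 'a set) \<Rightarrow> bool" where
  "cantor_scheme X C \<longleftrightarrow> C [] = X \<and>
    (\<forall>s. C s \<noteq> {} \<and> clopen_in X (C s) \<and>
      C (True # s) \<union> C (False # s) = C s \<and> C (True # s) \<inter> C (False # s) = {}) \<and>
    (\<forall>x\<in>X. \<forall>y\<in>X. (\<forall>s. x \<in> C s \<longleftrightarrow> y \<in> C s) \<longrightarrow> x = y)"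

text \<open>At level \<open>n\<close> every node is split by the \<open>n\<close>-th set of a separating sequence, if this set splits
  it at all, and arbitrarily otherwise, which is possible since there are no isolated points.
  Points separated by the \<open>n\<close>-th set lie in different nodes from level \<open>n + 1\<close> on.\<close>

lemma cantor_set_scheme:
  fixes X :: "'a::metric_space set"
  assumes X: "cantor_set X" "X \<noteq> {}"
  obtains C where "cantor_scheme X C"
proof -
  obtain U :: "nat \<Rightarrow> 'a set" where U: "\<And>n. clopen_in X (U n)"
    and sep: "\<And>x y. x \<in> X \<Longrightarrow> y \<in> X \<Longrightarrow> x \<noteq> y \<Longrightarrow> \<exists>n. x \<in> U n \<and> y \<notin> U n"
    using cantor_set_separating_sequence[OF X(1)] by metis
  define good where "good = (\<lambda>n C D. clopen_in X D \<and> D \<subseteq> C \<and> D \<noteq> {} \<and> C - D \<noteq> {} \<and>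
      (U n \<inter> C \<noteq> {} \<and> C - U n \<noteq> {} \<longrightarrow> D = U n \<inter> C))"
  have "\<exists>D. good n C D" if C: "clopen_in X C" "C \<noteq> {}" for C n
  proof (cases "U n \<inter> C \<noteq> {} \<and> C - U n \<noteq> {}")
    case True
    then have "good n C (U n \<inter> C)" using U C by (auto simp: good_def)
    then show ?thesis by blast
  next
    case False
    obtain D where D: "clopen_in C D" "D \<noteq> {}" "C - D \<noteq> {}"
      using cantor_set_split[OF cantor_set_clopen[OF X(1) C(1)] C(2)] .
    have "clopen_in X D" using clopen_in_trans[OF D(1) C(1)] .
    then have "good n C D" using D clopen_in_subset[OF D(1)] False unfolding good_def by blast
    then show ?thesis by blast
  qed
  moreover define spl where "spl = (\<lambda>n C. SOME D. good n C D)"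
  ultimately have "good n C (spl n C)" if "clopen_in X C" "C \<noteq> {}" for C n
    using that by (simp add: someI_ex)
  then have spl: "clopen_in X (spl n C)" "spl n C \<subseteq> C" "spl n C \<noteq> {}" "C - spl n C \<noteq> {}"
      "U n \<inter> C \<noteq> {} \<Longrightarrow> C - U n \<noteq> {} \<Longrightarrow> spl n C = U n \<inter> C"
    if "clopen_in X C" "C \<noteq> {}" for C n
    using that unfolding good_def by blast+
  define C where "C = rec_list X (\<lambda>b s A. if b then spl (length s) A else A - spl (length s) A)"
  have C_Nil: "C [] = X" and C_True: "C (True # s) = spl (length s) (C s)"
    and C_False: "C (False # s) = C s - spl (length s) (C s)" for s
    by (simp_all add: C_def)
  have C: "clopen_in X (C s)" "C s \<noteq> {}" for s
  proof (induction s)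
    case (Cons b s)
    { case 1 show ?case
        using spl(1)[OF Cons, of "length s"] Cons clopen_in_Diff[of X "C s"]
        by (cases b) (simp_all add: C_True C_False) }
    { case 2 show ?case
        using spl(3,4)[OF Cons, of "length s"] by (cases b) (simp_all add: C_True C_False) }
  qed (use X in \<open>auto simp: C_Nil\<close>)
  have split: "C (True # s) \<union> C (False # s) = C s" "C (True # s) \<inter> C (False # s) = {}" for s
    using spl(2)[OF C, of "length s"] unfolding C_True C_False by blast+
  have branch: "\<exists>s. length s = n \<and> x \<in> C s" if x: "x \<in> X" for n x
  proof (induction n)
    case (Suc n)
    then obtain s where "length s = n" "x \<in> C s" by blast
    then have "x \<in> C (True # s) \<or> x \<in> C (False # s)" using split(1) by blast
    then show ?case using \<open>length s = n\<close> by (metis length_Cons)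
  qed (use x in \<open>auto simp: C_Nil\<close>)
  have "x = y" if xy: "x \<in> X" "y \<in> X" and same: "\<And>s. x \<in> C s \<longleftrightarrow> y \<in> C s" for x y
  proof (rule ccontr)
    assume "x \<noteq> y"
    then obtain n where n: "x \<in> U n" "y \<notin> U n" using sep xy by blast
    obtain s where s: "length s = n" "x \<in> C s" using branch xy by blast
    then have "C (True # s) = U n \<inter> C s"
      unfolding C_True s(1) using spl(5)[OF C, of n] n same[of s] s(2) by blast
    then show False using n s same[of "True # s"] by auto
  qed
  then have "cantor_scheme X C"
    unfolding cantor_scheme_def using C split C_Nil by blast
  then show ?thesis by (rule that)
qed

lemma cantor_scheme_disjoint:
  assumes "cantor_scheme X C" "length s = length t" "x \<in> C s" "x \<in> C t"
  shows "s = t"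
  using assms(2-4)
proof (induction s t rule: list_induct2)
  case (Cons a s b t)
  have split: "C (True # s) \<union> C (False # s) = C s" "C (True # s) \<inter> C (False # s) = {}" for s
    using assms(1) by (simp_all add: cantor_scheme_def)
  have "C (c # s) \<subseteq> C s" for c s using split(1)[of s] by (cases c) auto
  then have "s = t" using Cons by blast
  moreover have "a = b"
    using split(2)[of s] Cons.prems \<open>s = t\<close> by (cases a; cases b) auto
  ultimately show ?case by simp
qed simp

lemma cantor_scheme_branch:
  assumes "cantor_scheme X C" "x \<in> X"
  obtains s where "s 0 = []" "\<And>n. \<exists>b. s (Suc n) = b # s n" "\<And>n. length (s n) = n" "\<And>n. x \<in> C (s n)"
proof -
  have split: "C (True # s) \<union> C (False # s) = C s" "C [] = X" for s
    using assms(1) by (auto simp: cantor_scheme_def)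
  define s where "s = rec_nat [] (\<lambda>_ s. if x \<in> C (True # s) then True # s else False # s)"
  have s: "s 0 = []" "s (Suc n) = (if x \<in> C (True # s n) then True # s n else False # s n)" for n
    by (simp_all add: s_def)
  have "x \<in> C (s n)" for n
    using split assms(2) by (induction n) (auto simp: s)
  moreover have "length (s n) = n" for n by (induction n) (auto simp: s)
  moreover have "\<exists>b. s (Suc n) = b # s n" for n
    by (cases "x \<in> C (True # s n)") (auto simp: s)
  ultimately show ?thesis using that[of s] s(1) by blast
qed

lemma compact_decreasing_nonempty:
  fixes D :: "nat \<Rightarrow> 'a::t2_space set"
  assumes "\<And>n. compact (D n)" "\<And>n. D n \<noteq> {}" "\<And>n. D (Suc n) \<subseteq> D n"
  shows "(\<Inter>n. D n) \<noteq> {}"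
proof -
  have dec: "D n \<subseteq> D m" if "m \<le> n" for m n
    by (rule lift_Suc_antimono_le[of D, OF assms(3) that])
  have "D 0 \<inter> \<Inter>(D ` UNIV) \<noteq> {}"
  proof (rule compact_imp_fip_image[where s = "D 0" and I = UNIV and f = D])
    fix I :: "nat set" assume "finite I"
    then have "D (Max (insert 0 I)) \<subseteq> D i" if "i \<in> insert 0 I" for i
      using that by (intro dec Max_ge) auto
    then have "D (Max (insert 0 I)) \<subseteq> D 0 \<inter> \<Inter>(D ` I)" by blast
    then show "D 0 \<inter> \<Inter>(D ` I) \<noteq> {}" using assms(2) by blast
  qed (use assms(1) in \<open>auto intro: compact_imp_closed\<close>)
  then show ?thesis by blast
qed

text \<open>The nodes containing \<open>x\<close> form a branch; compactness of \<open>Y\<close> gives a point on the corresponding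
  branch of \<open>D\<close>, and separation makes it unique.\<close>

lemma cantor_scheme_match:
  fixes Y :: "'b::t2_space set"
  assumes X: "cantor_scheme X C" and Y: "cantor_scheme Y D" "compact Y" and x: "x \<in> X"
  shows "\<exists>!y. y \<in> Y \<and> (\<forall>s. x \<in> C s \<longleftrightarrow> y \<in> D s)"
proof -
  obtain b where b: "b 0 = []" "\<And>n. \<exists>c. b (Suc n) = c # b n" "\<And>n. length (b n) = n" "\<And>n. x \<in> C (b n)"
    using cantor_scheme_branch[OF X x] by blast
  have D: "D s \<noteq> {}" "clopen_in Y (D s)" "D (c # s) \<subseteq> D s" "D [] = Y" for s c
    using Y(1) by (cases c; auto simp: cantor_scheme_def)+
  have "(\<Inter>n. D (b n)) \<noteq> {}"
  proof (rule compact_decreasing_nonempty)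
    show "compact (D (b n))" for n using D(2) Y(2) closedin_compact by blast
    show "D (b (Suc n)) \<subseteq> D (b n)" for n by (metis b(2) D(3))
  qed (use D in auto)
  then obtain y where y: "\<And>n. y \<in> D (b n)" by blast
  have "x \<in> C s \<longleftrightarrow> s = b (length s)" for s
    using cantor_scheme_disjoint[OF X _ _ b(4)] b(4)[of "length s"] by (metis b(3))
  moreover have "y \<in> D s \<longleftrightarrow> s = b (length s)" for s
    using cantor_scheme_disjoint[OF Y(1) _ _ y] y[of "length s"] by (metis b(3))
  ultimately have same: "x \<in> C s \<longleftrightarrow> y \<in> D s" for s by simp
  have yY: "y \<in> Y" using y[of 0] b(1) D(4) by simp
  have "y' = y" if "y' \<in> Y" "\<forall>s. x \<in> C s \<longleftrightarrow> y' \<in> D s" for y'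
  proof -
    have "\<forall>s. y' \<in> D s \<longleftrightarrow> y \<in> D s" using that(2) same by simp
    then show ?thesis using Y(1) that(1) yY unfolding cantor_scheme_def by blast
  qed
  with yY same show ?thesis by blast
qed

text \<open>If no node on the branch of \<open>y\<close> is contained in \<open>V\<close>, then by compactness the branch contains a
  point outside \<open>V\<close>, which \<open>D\<close> does not separate from \<open>y\<close>.\<close>

lemma cantor_scheme_base:
  fixes Y :: "'b::t2_space set"
  assumes Y: "cantor_scheme Y D" "compact Y" and V: "openin (top_of_set Y) V" "y \<in> V"
  shows "\<exists>s. y \<in> D s \<and> D s \<subseteq> V"
proof (rule ccontr)
  assume none: "\<not> ?thesis"
  have "y \<in> Y" using V openin_imp_subset by blast
  obtain b where b: "b 0 = []" "\<And>n. \<exists>c. b (Suc n) = c # b n" "\<And>n. length (b n) = n" "\<And>n. y \<in> D (b n)"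
    using cantor_scheme_branch[OF Y(1) \<open>y \<in> Y\<close>] by blast
  have D: "clopen_in Y (D s)" "D (c # s) \<subseteq> D s" for s c
    using Y(1) by (cases c; auto simp: cantor_scheme_def)+
  have "(\<Inter>n. D (b n) - V) \<noteq> {}"
  proof (rule compact_decreasing_nonempty)
    have "closedin (top_of_set Y) (D (b n) - V)" for n
      using D(1) V by (intro closedin_diff) auto
    then show "compact (D (b n) - V)" for n using Y(2) closedin_compact by blast
    show "D (b (Suc n)) - V \<subseteq> D (b n) - V" for n by (metis b(2) D(2) Diff_mono order_refl)
    show "D (b n) - V \<noteq> {}" for n using none b(4)[of n] by blast
  qed
  then obtain w where w: "\<And>n. w \<in> D (b n)" "w \<notin> V" by blast
  have "w \<in> Y" using w(1)[of 0] b Y(1) by (simp add: cantor_scheme_def)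
  have "w \<in> D s \<longleftrightarrow> s = b (length s)" for s
    using cantor_scheme_disjoint[OF Y(1) _ _ w(1)] w(1)[of "length s"] by (metis b(3))
  moreover have "y \<in> D s \<longleftrightarrow> s = b (length s)" for s
    using cantor_scheme_disjoint[OF Y(1) _ _ b(4)] b(4)[of "length s"] by (metis b(3))
  ultimately have "w \<in> D s \<longleftrightarrow> y \<in> D s" for s by simp
  then have "w = y" using Y(1) \<open>w \<in> Y\<close> \<open>y \<in> Y\<close> unfolding cantor_scheme_def by blast
  then show False using w V by blast
qed

text \<open>Brouwer's theorem.  Points on the same branch of the two trees are matched; nodes go to
  nodes, and nodes form a base of the topology.\<close>

theorem cantor_sets_homeomorphic:
  fixes X :: "'a::metric_space set" and Y :: "'b::metric_space set"
  assumes X: "cantor_set X" "X \<noteq> {}" and Y: "cantor_set Y" "Y \<noteq> {}"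
  shows "X homeomorphic Y"
proof -
  obtain C where C: "cantor_scheme X C" using cantor_set_scheme[OF X] .
  obtain D where D: "cantor_scheme Y D" using cantor_set_scheme[OF Y] .
  have cpt: "compact X" "compact Y" using X Y by (auto simp: cantor_set_def)
  obtain h where h: "\<And>x. x \<in> X \<Longrightarrow> h x \<in> Y" "\<And>x s. x \<in> X \<Longrightarrow> x \<in> C s \<longleftrightarrow> h x \<in> D s"
    using cantor_scheme_match[OF C D cpt(2)] by metis
  have sepC: "x = x'" if "x \<in> X" "x' \<in> X" "\<And>s. x \<in> C s \<longleftrightarrow> x' \<in> C s" for x x'
    using C that unfolding cantor_scheme_def by blast
  have sepD: "y = y'" if "y \<in> Y" "y' \<in> Y" "\<And>s. y \<in> D s \<longleftrightarrow> y' \<in> D s" for y y'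
    using D that unfolding cantor_scheme_def by blast
  have "y \<in> h ` X" if y: "y \<in> Y" for y
  proof -
    obtain x where x: "x \<in> X" "\<And>s. y \<in> D s \<longleftrightarrow> x \<in> C s"
      using cantor_scheme_match[OF D C cpt(1) y] by blast
    have "h x = y"
      using h(1)[OF x(1)] y by (rule sepD) (simp add: x(2) h(2)[OF x(1)])
    then show ?thesis using x(1) by blast
  qed
  then have surj: "h ` X = Y" using h(1) by blast
  have inj: "inj_on h X"
  proof (rule inj_onI)
    fix x x' assume x: "x \<in> X" "x' \<in> X" "h x = h x'"
    show "x = x'"
      using x(1,2) by (rule sepC) (simp add: h(2)[OF x(1)] h(2)[OF x(2)] x(3))
  qed
  have "openin (top_of_set X) (X \<inter> h -` V)" if V: "openin (top_of_set Y) V" for V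
  proof (subst openin_subopen, intro ballI)
    fix x assume x: "x \<in> X \<inter> h -` V"
    then obtain s where s: "h x \<in> D s" "D s \<subseteq> V"
      using cantor_scheme_base[OF D cpt(2) V, of "h x"] by blast
    have ope: "openin (top_of_set X) (C s)" using C by (simp add: cantor_scheme_def)
    then have sub: "C s \<subseteq> X" by (rule openin_imp_subset)
    have "x \<in> C s" using s x h(2)[of x s] by simp
    moreover have "C s \<subseteq> X \<inter> h -` V" using sub s(2) h(2) by blast
    ultimately show "\<exists>T. openin (top_of_set X) T \<and> x \<in> T \<and> T \<subseteq> X \<inter> h -` V"
      using ope by blast
  qed
  moreover have "h \<in> X \<rightarrow> Y" using h(1) by blast
  ultimately have "continuous_on X h" using continuous_on_open_gen by blast
  then show ?thesis
    unfolding homeomorphic_def using homeomorphism_compact[OF cpt(1) _ surj inj] by blast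
qed

section \<open>Sequences of copies of a Cantor set\<close>

text \<open>A connected subset of a metric space with two points is uncountable, so \<open>J\<close> is totally
  disconnected.  No point of the product is isolated because no point of \<open>A\<close> is.\<close>

lemma cantor_set_Times_countable:
  fixes A :: "'a::metric_space set" and J :: "'b::metric_space set"
  assumes A: "cantor_set A" and J: "compact J" "countable J"
  shows "cantor_set (A \<times> J)"
proof -
  have "x = y" if C: "C \<subseteq> A \<times> J" "connected C" "x \<in> C" "y \<in> C" for C x y
  proof -
    have "connected (fst ` C)" "connected (snd ` C)"
      using C(2) by (auto intro!: connected_continuous_image continuous_intros)
    moreover have "fst ` C \<subseteq> A" "snd ` C \<subseteq> J" using C(1) by auto
    moreover have "countable (snd ` C)" using \<open>snd ` C \<subseteq> J\<close> J(2) countable_subset by blast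
    ultimately have "fst x = fst y" "snd x = snd y"
      using A C(3,4) connected_uncountable[of "snd ` C" "snd x" "snd y"]
      by (auto simp: cantor_set_def totally_disconnected_iff)
    then show ?thesis by (simp add: prod_eq_iff)
  qed
  then have "totally_disconnected (A \<times> J)" unfolding totally_disconnected_iff by blast
  moreover have "x islimpt A \<times> J" if x: "x \<in> A \<times> J" for x
  proof (rule islimptI)
    fix T assume "x \<in> T" "open T"
    then obtain U V where UV: "open U" "fst x \<in> U" "snd x \<in> V" "U \<times> V \<subseteq> T"
      by (metis open_prod_elim mem_Times_iff)
    have "fst x islimpt A" using A x by (auto simp: cantor_set_def)
    then obtain y where "y \<in> A" "y \<in> U" "y \<noteq> fst x"
      using UV by (meson islimptE)
    then show "\<exists>y\<in>A \<times> J. y \<in> T \<and> y \<noteq> x"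
      using UV x by (intro bexI[of _ "(y, snd x)"]) auto
  qed
  ultimately show ?thesis using A J by (auto simp: cantor_set_def intro: compact_Times)
qed

lemma continuous_on_openin_pieces:
  assumes "\<And>x. x \<in> K \<Longrightarrow> \<exists>A. openin (top_of_set K) A \<and> x \<in> A \<and> continuous_on A f"
  shows "continuous_on K f"
  unfolding continuous_on_def
proof
  fix x assume "x \<in> K"
  then obtain A where A: "openin (top_of_set K) A" "x \<in> A" "continuous_on A f"
    using assms by blast
  obtain V where V: "open V" "A = K \<inter> V" using A(1) by (auto simp: openin_open)
  have "at x within K = at x within A"
    by (rule at_within_nhd[of x V]) (use A V in auto)
  then show "(f \<longlongrightarrow> f x) (at x within K)"
    using A(2,3) by (simp add: continuous_on_def)
qed

text \<open>The set \<open>{0, \<dots>, 1/4, 1/3, 1/2}\<close> indexes the copies of a clopen set.  The next larger index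
  is \<open>t / (1 - t)\<close>, which maps \<open>1/(n + 3)\<close> to \<open>1/(n + 2)\<close> and fixes \<open>0\<close>.\<close>

definition reciprocals :: "real set" where
  "reciprocals = insert 0 (range (\<lambda>n::nat. 1 / (real n + 2)))"

lemma compact_reciprocals: "compact reciprocals"
proof -
  have "(\<lambda>n::nat. 1 / (real n + 2)) \<longlonglongrightarrow> 0" by real_asymp
  then show ?thesis unfolding reciprocals_def by (rule compact_sequence_with_limit)
qed

lemma countable_reciprocals: "countable reciprocals"
  by (simp add: reciprocals_def)

lemma reciprocals_half: "1 / 2 \<in> reciprocals"
  by (auto simp: reciprocals_def intro!: image_eqI[of _ _ 0])

text \<open>The bound lies between \<open>1/3\<close> and \<open>1/2\<close>, so \<open>1/2\<close> is an isolated point.\<close>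

lemma reciprocals_greater:
  assumes "t \<in> reciprocals" "t > 5 / 12"
  shows "t = 1 / 2"
proof -
  obtain n :: nat where n: "t = 1 / (real n + 2)"
    using assms by (auto simp: reciprocals_def)
  have "n = 0"
  proof (rule ccontr)
    assume "n \<noteq> 0"
    then have "t \<le> 1 / 3" unfolding n by (intro frac_le) auto
    then show False using assms(2) by simp
  qed
  then show ?thesis using n by simp
qed

lemma reciprocals_shift:
  "bij_betw (\<lambda>t. t / (1 - t)) (reciprocals - {1 / 2}) reciprocals"
proof (rule bij_betw_byWitness[where f' = "\<lambda>t. t / (1 + t)"])
  have nonneg: "0 \<le> t" "t < 1" if "t \<in> reciprocals" for t
    using that by (auto simp: reciprocals_def)
  show "\<forall>t\<in>reciprocals - {1 / 2}. (t / (1 - t)) / (1 + t / (1 - t)) = t"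
  proof
    fix t assume "t \<in> reciprocals - {1 / 2}"
    then have "t < 1" using nonneg by blast
    then show "(t / (1 - t)) / (1 + t / (1 - t)) = t" by (simp add: field_simps)
  qed
  show "\<forall>t\<in>reciprocals. (t / (1 + t)) / (1 - t / (1 + t)) = t"
  proof
    fix t assume "t \<in> reciprocals"
    then have "0 \<le> t" using nonneg by blast
    then show "(t / (1 + t)) / (1 - t / (1 + t)) = t" by (simp add: field_simps)
  qed
  show "(\<lambda>t. t / (1 - t)) ` (reciprocals - {1 / 2}) \<subseteq> reciprocals"
  proof (intro image_subsetI)
    fix t assume t: "t \<in> reciprocals - {1 / 2}"
    show "t / (1 - t) \<in> reciprocals"
    proof (cases "t = 0")
      case False
      then obtain n :: nat where n: "t = 1 / (real n + 2)" using t by (auto simp: reciprocals_def)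
      then obtain m where m: "n = Suc m" using t by (cases n) auto
      have "t / (1 - t) = 1 / (real m + 2)" unfolding n m by (simp add: divide_simps)
      then show ?thesis by (auto simp: reciprocals_def)
    qed (simp add: reciprocals_def)
  qed
  show "(\<lambda>t. t / (1 + t)) ` reciprocals \<subseteq> reciprocals - {1 / 2}"
  proof (intro image_subsetI)
    fix t assume t: "t \<in> reciprocals"
    show "t / (1 + t) \<in> reciprocals - {1 / 2}"
    proof (cases "t = 0")
      case False
      then obtain n :: nat where n: "t = 1 / (real n + 2)" using t by (auto simp: reciprocals_def)
      have "t / (1 + t) = 1 / (real (Suc n) + 2)" unfolding n by (simp add: divide_simps)
      moreover have "1 / (real (Suc n) + 2) \<noteq> 1 / 2" by (simp add: field_simps)
      ultimately show ?thesis unfolding reciprocals_def by (metis Diff_iff insertCI rangeI singletonD)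
    qed (simp add: reciprocals_def)
  qed
qed

section \<open>Homeomorphisms that are the identity near a point\<close>

lemma homeo_germ_stabilizer_carrier:
  "f \<in> carrier (homeo_germ_stabilizer K z) \<longleftrightarrow>
    f \<in> Bij K \<and> (\<exists>g. homeomorphism K K f g) \<and>
    (\<exists>U. openin (top_of_set K) U \<and> z \<in> U \<and> (\<forall>x\<in>U. f x = x))"
  by (auto simp: homeo_germ_stabilizer_def homeo_group_def)

text \<open>On a compact space the inverse of a continuous bijection is automatically continuous.\<close>

lemma homeo_germ_stabilizerI:
  fixes K :: "'a::t2_space set"
  assumes "compact K" "f \<in> extensional K" "bij_betw f K K" "continuous_on K f"
    and "openin (top_of_set K) U" "z \<in> U" "\<And>x. x \<in> U \<Longrightarrow> f x = x"
  shows "f \<in> carrier (homeo_germ_stabilizer K z)"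
proof -
  have "\<exists>g. homeomorphism K K f g"
    using assms(1,3,4) by (intro homeomorphism_compact) (auto simp: bij_betw_def)
  then show ?thesis using assms by (auto simp: homeo_germ_stabilizer_carrier Bij_def)
qed

lemma homeo_germ_stabilizer_mult:
  assumes "f \<in> carrier (homeo_germ_stabilizer K z)" "g \<in> carrier (homeo_germ_stabilizer K z)"
  shows "f \<otimes>\<^bsub>homeo_germ_stabilizer K z\<^esub> g = compose K f g"
  using assms
  by (simp add: homeo_germ_stabilizer_def homeo_group_def BijGroup_def)

lemma homeo_germ_stabilizer_one: "\<one>\<^bsub>homeo_germ_stabilizer K z\<^esub> = (\<lambda>x\<in>K. x)"
  by (simp add: homeo_germ_stabilizer_def homeo_group_def BijGroup_def)

lemma group_homeo_germ_stabilizer: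
  assumes z: "z \<in> K"
  shows "group (homeo_germ_stabilizer K z)"
proof -
  interpret H: group "homeo_group K" by (rule group_homeo_group)
  let ?S = "{g \<in> carrier (homeo_group K).
       \<exists>U. openin (top_of_set K) U \<and> z \<in> U \<and> (\<forall>x\<in>U. g x = x)}"
  have mult: "f \<otimes>\<^bsub>homeo_group K\<^esub> g = compose K f g"
    if "f \<in> carrier (homeo_group K)" "g \<in> carrier (homeo_group K)" for f g
    using that by (simp add: homeo_group_def BijGroup_def)
  have one: "\<one>\<^bsub>homeo_group K\<^esub> = (\<lambda>x\<in>K. x)"
    by (simp add: homeo_group_def BijGroup_def)
  have "subgroup ?S (homeo_group K)"
  proof (rule H.subgroupI)
    have "\<one>\<^bsub>homeo_group K\<^esub> \<in> ?S"
      using z H.one_closed by (auto simp: one intro!: exI[of _ K])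
    then show "?S \<noteq> {}" by blast
  next
    fix f assume "f \<in> ?S"
    then obtain U where f: "f \<in> carrier (homeo_group K)"
      and U: "openin (top_of_set K) U" "z \<in> U" "\<And>x. x \<in> U \<Longrightarrow> f x = x" by blast
    have "(inv\<^bsub>homeo_group K\<^esub> f) x = x" if x: "x \<in> U" for x
    proof -
      have xK: "x \<in> K" using U(1) x openin_imp_subset by blast
      have "compose K (inv\<^bsub>homeo_group K\<^esub> f) f = (\<lambda>x\<in>K. x)"
        using H.l_inv[OF f] mult[OF H.inv_closed[OF f] f] one by simp
      from fun_cong[OF this, of x] show ?thesis using xK U(3)[OF x] by (simp add: compose_def)
    qed
    then show "inv\<^bsub>homeo_group K\<^esub> f \<in> ?S" using f U(1,2) H.inv_closed by blast
  next
    fix f g assume "f \<in> ?S" "g \<in> ?S"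
    then obtain U V where f: "f \<in> carrier (homeo_group K)" and g: "g \<in> carrier (homeo_group K)"
      and U: "openin (top_of_set K) U" "z \<in> U" "\<And>x. x \<in> U \<Longrightarrow> f x = x"
      and V: "openin (top_of_set K) V" "z \<in> V" "\<And>x. x \<in> V \<Longrightarrow> g x = x" by blast
    have "\<forall>x\<in>U \<inter> V. compose K f g x = x"
      using U V openin_imp_subset[OF U(1)] by (auto simp: compose_def)
    then have "\<exists>W. openin (top_of_set K) W \<and> z \<in> W \<and> (\<forall>x\<in>W. compose K f g x = x)"
      using U V by (intro exI[of _ "U \<inter> V"]) auto
    then show "f \<otimes>\<^bsub>homeo_group K\<^esub> g \<in> ?S"
      using mult[OF f g] H.m_closed[OF f g] by simp
  qed blast
  then show ?thesis
    unfolding homeo_germ_stabilizer_def by (rule subgroup.subgroup_is_group) (rule group_homeo_group)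
qed

definition supported_on ::
  "('a::topological_space \<Rightarrow> 'a) set \<Rightarrow> 'a set \<Rightarrow> 'a set \<Rightarrow> ('a \<Rightarrow> 'a) set" where
  "supported_on \<Gamma> K A = {g \<in> \<Gamma>. \<forall>x\<in>K - A. g x = x}"

lemma supported_on_image:
  assumes h: "h \<in> supported_on \<Gamma> K A" "bij_betw h K K" and A: "A \<subseteq> K"
  shows "h ` A = A"
proof -
  have "h ` (K - A) = K - A" using h by (force simp: supported_on_def)
  moreover have "h ` (K - (K - A)) = h ` K - h ` (K - A)"
    using h(2) by (intro inj_on_image_set_diff[of _ K]) (auto simp: bij_betw_def)
  ultimately show ?thesis using h(2) A by (simp add: bij_betw_def double_diff)
qed

lemma homeo_germ_stabilizer_memD:
  assumes "f \<in> carrier (homeo_germ_stabilizer K z)"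
  shows "bij_betw f K K" "continuous_on K f" "f \<in> extensional K"
  using assms by (auto simp: homeo_germ_stabilizer_carrier Bij_def homeomorphism_def)

lemma subgroup_supported_on:
  assumes z: "z \<in> K"
  shows "subgroup (supported_on (carrier (homeo_germ_stabilizer K z)) K A) (homeo_germ_stabilizer K z)"
    (is "subgroup ?H ?G")
proof -
  interpret G: group ?G using z by (rule group_homeo_germ_stabilizer)
  show ?thesis
  proof (rule G.subgroupI)
    show "?H \<noteq> {}"
      using G.one_closed by (auto simp: supported_on_def homeo_germ_stabilizer_one)
  next
    fix h assume h: "h \<in> ?H"
    then have hG: "h \<in> carrier ?G" by (simp add: supported_on_def)
    have eq: "compose K (inv\<^bsub>?G\<^esub> h) h = (\<lambda>x\<in>K. x)"
      using G.l_inv[OF hG] homeo_germ_stabilizer_mult[OF G.inv_closed[OF hG] hG]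
      by (simp add: homeo_germ_stabilizer_one)
    have "(inv\<^bsub>?G\<^esub> h) x = x" if x: "x \<in> K - A" for x
      using fun_cong[OF eq, of x] x h by (simp add: compose_def supported_on_def)
    then show "inv\<^bsub>?G\<^esub> h \<in> ?H" using G.inv_closed[OF hG] by (simp add: supported_on_def)
  next
    fix h k assume hk: "h \<in> ?H" "k \<in> ?H"
    then have hkG: "h \<in> carrier ?G" "k \<in> carrier ?G" by (simp_all add: supported_on_def)
    have "(h \<otimes>\<^bsub>?G\<^esub> k) x = x" if "x \<in> K - A" for x
      using homeo_germ_stabilizer_mult[OF hkG] hk that by (simp add: supported_on_def compose_def)
    then show "h \<otimes>\<^bsub>?G\<^esub> k \<in> ?H"
      using G.m_closed[OF hkG] by (simp add: supported_on_def)
  qed (auto simp: supported_on_def)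
qed

lemma supported_on_disjoint_commute:
  fixes K :: "'a::metric_space set" and z :: 'a
  defines "G \<equiv> homeo_germ_stabilizer K z"
  assumes A: "A \<subseteq> K" "W \<subseteq> K" "A \<inter> W = {}"
    and s: "s \<in> supported_on (carrier G) K A" and u: "u \<in> supported_on (carrier G) K W"
  shows "s \<otimes>\<^bsub>G\<^esub> u = u \<otimes>\<^bsub>G\<^esub> s"
proof -
  have sG: "s \<in> carrier G" and uG: "u \<in> carrier G" using s u by (auto simp: supported_on_def)
  have sA: "s x \<in> A" if "x \<in> A" for x
    using supported_on_image[OF s _ A(1)] homeo_germ_stabilizer_memD(1) sG that unfolding G_def by blast
  have uW: "u x \<in> W" if "x \<in> W" for x
    using supported_on_image[OF u _ A(2)] homeo_germ_stabilizer_memD(1) uG that unfolding G_def by blast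
  have fixed: "s x = x" if "x \<in> K - A" for x using that s by (simp add: supported_on_def)
  have fixed': "u x = x" if "x \<in> K - W" for x using that u by (simp add: supported_on_def)
  have "s (u x) = u (s x)" if x: "x \<in> K" for x
  proof -
    consider "x \<in> A" | "x \<in> W" | "x \<in> K - A" "x \<in> K - W" using x by blast
    then show ?thesis
    proof cases
      case 1
      then have "x \<in> K - W" "s x \<in> K - W" using sA A by blast+
      then show ?thesis using fixed' by simp
    next
      case 2
      then have "x \<in> K - A" "u x \<in> K - A" using uW A by blast+
      then show ?thesis using fixed by simp
    qed (use fixed fixed' in simp)
  qed
  then have "compose K s u = compose K u s" by (auto simp: compose_def)
  then show ?thesis using homeo_germ_stabilizer_mult sG uG unfolding G_def by metis
qed

section \<open>The infinite copy and the shift\<close>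

text \<open>\<open>A\<close> is the given support, \<open>W\<close> consists of the copies of \<open>A\<close>, with coordinates \<open>p\<close> and
  parametrization \<open>q\<close>, and \<open>V\<close> is the set that absorbs \<open>A\<close> by means of \<open>r\<close>.\<close>

locale cantor_mitosis =
  fixes K :: "'a::metric_space set" and z :: 'a and A W V :: "'a set"
    and p :: "'a \<Rightarrow> 'a \<times> real" and q :: "'a \<times> real \<Rightarrow> 'a" and r :: "'a \<Rightarrow> 'a" and r' :: "'a \<Rightarrow> 'a"
  assumes K: "compact K" and z: "z \<in> K" "z \<notin> A" "z \<notin> W" "z \<notin> V"
    and clopen: "clopen_in K A" "clopen_in K W" "clopen_in K V"
    and disjoint: "A \<inter> W = {}" "A \<inter> V = {}" "W \<inter> V = {}"
    and pq: "homeomorphism W (A \<times> reciprocals) p q"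
    and r: "homeomorphism (A \<union> V) V r r'"
begin

abbreviation "G \<equiv> homeo_germ_stabilizer K z"
abbreviation "H \<equiv> supported_on (carrier G) K A"

lemma subsets: "A \<subseteq> K" "W \<subseteq> K" "V \<subseteq> K"
  using clopen clopen_in_subset by blast+

lemma p_in: "x \<in> W \<Longrightarrow> fst (p x) \<in> A" "x \<in> W \<Longrightarrow> snd (p x) \<in> reciprocals"
  using pq by (auto simp: homeomorphism_def mem_Times_iff)

lemma q_in: "a \<in> A \<Longrightarrow> t \<in> reciprocals \<Longrightarrow> q (a, t) \<in> W"
  using pq by (auto simp: homeomorphism_def)

lemma q_p [simp]: "x \<in> W \<Longrightarrow> q (p x) = x"
  using pq by (auto simp: homeomorphism_def)

lemma p_q [simp]: "a \<in> A \<Longrightarrow> t \<in> reciprocals \<Longrightarrow> p (q (a, t)) = (a, t)"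
  using pq by (auto simp: homeomorphism_def)

lemma cont_p: "continuous_on W p" and cont_q: "continuous_on (A \<times> reciprocals) q"
  using pq by (auto simp: homeomorphism_def)

lemma r_in: "x \<in> A \<union> V \<Longrightarrow> r x \<in> V"
  using r by (auto simp: homeomorphism_def)

text \<open>Continuity on the limit copy \<open>A \<times> {0}\<close> holds because \<open>h\<close> acts there too; in the coordinates on \<open>W\<close> the map is the
  product of \<open>h\<close> with the identity.\<close>

definition infinite_copy :: "('a \<Rightarrow> 'a) \<Rightarrow> 'a \<Rightarrow> 'a" where
  "infinite_copy h = (\<lambda>x\<in>K. if x \<in> A then h x
     else if x \<in> W then q (h (fst (p x)), snd (p x)) else x)"

text \<open>As \<open>W\<close> goes onto \<open>A \<union> W\<close>, a bijection of \<open>K\<close> has to send \<open>A\<close> elsewhere; \<open>r\<close> makes \<open>V\<close>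
  absorb it.\<close>

definition shift :: "'a \<Rightarrow> 'a" where
  "shift = (\<lambda>x\<in>K. if x \<in> A \<union> V then r x
     else if x \<in> W then (if snd (p x) = 1 / 2 then fst (p x)
       else q (fst (p x), snd (p x) / (1 - snd (p x)))) else x)"

lemma H_maps: "h \<in> H \<Longrightarrow> a \<in> A \<Longrightarrow> h a \<in> A"
  using supported_on_image[of h "carrier G" K A] homeo_germ_stabilizer_memD(1) subsets(1)
  by (auto simp: supported_on_def)

lemma infinite_copy_compose:
  assumes h: "h \<in> H" and k: "k \<in> H" and x: "x \<in> K"
  shows "infinite_copy h (infinite_copy k x) = infinite_copy (compose K h k) x"
proof -
  consider "x \<in> A" | "x \<in> W" "x \<notin> A" | "x \<notin> A" "x \<notin> W" by blast
  then show ?thesis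
  proof cases
    case 1
    then show ?thesis using H_maps[OF k] subsets(1) by (auto simp: infinite_copy_def compose_def)
  next
    case 2
    then have "q (k (fst (p x)), snd (p x)) \<in> W" using H_maps[OF k] p_in q_in by blast
    then show ?thesis
      using 2 H_maps[OF k] p_in[OF 2(1)] subsets disjoint
      by (auto simp: infinite_copy_def compose_def)
  next
    case 3
    then show ?thesis using x by (simp add: infinite_copy_def)
  qed
qed

lemma infinite_copy_one: "x \<in> K \<Longrightarrow> infinite_copy (\<lambda>x\<in>K. x) x = x"
  using p_in subsets by (auto simp: infinite_copy_def)

lemma group_G: "group G"
  using z(1) by (rule group_homeo_germ_stabilizer)

lemma continuous_infinite_copy:
  assumes h: "h \<in> H"
  shows "continuous_on K (infinite_copy h)"
proof (rule continuous_on_openin_pieces)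
  fix x assume x: "x \<in> K"
  have hK: "continuous_on K h"
    using h homeo_germ_stabilizer_memD(2) by (auto simp: supported_on_def)
  then have hA: "continuous_on A h" using subsets(1) continuous_on_subset by blast
  have "continuous_on A (infinite_copy h)"
    using hA by (rule continuous_on_eq) (use subsets in \<open>auto simp: infinite_copy_def\<close>)
  moreover have "continuous_on W (\<lambda>x. q (h (fst (p x)), snd (p x)))"
  proof (rule continuous_on_compose2[OF cont_q])
    have "continuous_on W (\<lambda>x. h (fst (p x)))"
      by (rule continuous_on_compose2[OF hA]) (use p_in cont_p in \<open>auto intro!: continuous_intros\<close>)
    then show "continuous_on W (\<lambda>x. (h (fst (p x)), snd (p x)))"
      using cont_p by (intro continuous_intros)
  qed (use p_in H_maps[OF h] in auto)
  then have "continuous_on W (infinite_copy h)"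
    by (rule continuous_on_eq) (use subsets disjoint in \<open>auto simp: infinite_copy_def\<close>)
  moreover have "continuous_on (K - (A \<union> W)) (infinite_copy h)"
    using continuous_on_id by (rule continuous_on_eq) (auto simp: infinite_copy_def)
  moreover have "clopen_in K (K - (A \<union> W))"
    using clopen by (intro clopen_in_Diff clopen_in_Un clopen_in_self)
  ultimately show "\<exists>B. openin (top_of_set K) B \<and> x \<in> B \<and> continuous_on B (infinite_copy h)"
    using x clopen by blast
qed

lemma inv_in_H:
  assumes h: "h \<in> H"
  shows "inv\<^bsub>G\<^esub> h \<in> H" "compose K h (inv\<^bsub>G\<^esub> h) = (\<lambda>x\<in>K. x)" "compose K (inv\<^bsub>G\<^esub> h) h = (\<lambda>x\<in>K. x)"
proof -
  interpret G: group G by (rule group_G)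
  have hG: "h \<in> carrier G" using h by (simp add: supported_on_def)
  show "compose K h (inv\<^bsub>G\<^esub> h) = (\<lambda>x\<in>K. x)" and "compose K (inv\<^bsub>G\<^esub> h) h = (\<lambda>x\<in>K. x)"
    using G.r_inv[OF hG] G.l_inv[OF hG] homeo_germ_stabilizer_mult[OF hG G.inv_closed[OF hG]]
      homeo_germ_stabilizer_mult[OF G.inv_closed[OF hG] hG] by (simp_all add: homeo_germ_stabilizer_one)
  show "inv\<^bsub>G\<^esub> h \<in> H"
    using subgroup.m_inv_closed[OF subgroup_supported_on[OF z(1)] h] .
qed

lemma infinite_copy_in_K:
  assumes "h \<in> H" "x \<in> K" shows "infinite_copy h x \<in> K"
  using assms H_maps p_in q_in subsets by (auto simp: infinite_copy_def)

lemma infinite_copy_closed: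
  assumes h: "h \<in> H"
  shows "infinite_copy h \<in> carrier G"
proof (rule homeo_germ_stabilizerI[OF K])
  have inv: "infinite_copy h (infinite_copy (inv\<^bsub>G\<^esub> h) x) = x"
    "infinite_copy (inv\<^bsub>G\<^esub> h) (infinite_copy h x) = x" if "x \<in> K" for x
    using infinite_copy_compose[OF h inv_in_H(1)[OF h] that]
      infinite_copy_compose[OF inv_in_H(1)[OF h] h that] infinite_copy_one[OF that] inv_in_H[OF h]
    by simp_all
  show "bij_betw (infinite_copy h) K K"
    by (rule bij_betw_byWitness[where f' = "infinite_copy (inv\<^bsub>G\<^esub> h)"])
      (use inv infinite_copy_in_K[OF h] infinite_copy_in_K[OF inv_in_H(1)[OF h]] in auto)
  show "openin (top_of_set K) (K - (A \<union> W))"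
    using clopen by (intro openin_diff) auto
  show "z \<in> K - (A \<union> W)" using z by simp
  show "infinite_copy h x = x" if "x \<in> K - (A \<union> W)" for x
    using that by (simp add: infinite_copy_def)
qed (use continuous_infinite_copy[OF h] in \<open>auto simp: infinite_copy_def\<close>)

lemma infinite_copy_hom: "infinite_copy \<in> hom (G\<lparr>carrier := H\<rparr>) G"
proof (rule homI)
  fix h k assume "h \<in> carrier (G\<lparr>carrier := H\<rparr>)" "k \<in> carrier (G\<lparr>carrier := H\<rparr>)"
  then have hk: "h \<in> H" "k \<in> H" by auto
  then have hkG: "h \<in> carrier G" "k \<in> carrier G" by (auto simp: supported_on_def)
  have "infinite_copy (compose K h k) = compose K (infinite_copy h) (infinite_copy k)"
    using infinite_copy_compose[OF hk]
    by (intro extensionalityI[where A = K]) (auto simp: compose_def, auto simp: infinite_copy_def)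
  then show "infinite_copy (h \<otimes>\<^bsub>G\<lparr>carrier := H\<rparr>\<^esub> k) = infinite_copy h \<otimes>\<^bsub>G\<^esub> infinite_copy k"
    using homeo_germ_stabilizer_mult[OF hkG]
      homeo_germ_stabilizer_mult[OF infinite_copy_closed[OF hk(1)] infinite_copy_closed[OF hk(2)]]
    by simp
qed (simp add: infinite_copy_closed)

text \<open>The copy that \<open>shift\<close> moves onto \<open>A\<close>.\<close>

definition front :: "'a set" where "front = {x \<in> W. snd (p x) = 1 / 2}"

lemma clopen_front: "clopen_in K front"
proof -
  have cont: "continuous_on W (\<lambda>x. snd (p x))" using cont_p by (intro continuous_intros)
  \<comment> \<open>An open and a closed condition on the second coordinate describe the same set.\<close>
  have "front = W \<inter> (\<lambda>x. snd (p x)) -` {5 / 12<..}"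
    using p_in(2) reciprocals_greater by (auto simp: front_def)
  moreover have "openin (top_of_set W) (W \<inter> (\<lambda>x. snd (p x)) -` {5 / 12<..})"
    by (rule continuous_openin_preimage_gen[OF cont]) simp
  moreover have "front = W \<inter> (\<lambda>x. snd (p x)) -` {1 / 2}"
    by (auto simp: front_def)
  moreover have "closedin (top_of_set W) (W \<inter> (\<lambda>x. snd (p x)) -` {1 / 2})"
    by (rule continuous_closedin_preimage[OF cont]) simp
  ultimately have "clopen_in W front" by simp
  then show ?thesis using clopen(2) clopen_in_trans by blast
qed

lemma shift_simps:
  "x \<in> A \<union> V \<Longrightarrow> shift x = r x"
  "x \<in> front \<Longrightarrow> shift x = fst (p x)"
  "x \<in> W - front \<Longrightarrow> shift x = q (fst (p x), snd (p x) / (1 - snd (p x)))"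
  "x \<in> K - (A \<union> V \<union> W) \<Longrightarrow> shift x = x"
  using subsets disjoint by (auto simp: shift_def front_def)

lemma lower_index_in: "t \<in> reciprocals \<Longrightarrow> t \<noteq> 1 / 2 \<Longrightarrow> t / (1 - t) \<in> reciprocals"
  using reciprocals_shift by (auto simp: bij_betw_def)

lemma bij_shift: "bij_betw shift K K"
proof -
  have "bij_betw r (A \<union> V) V"
    by (rule bij_betw_byWitness[where f' = r']) (use r in \<open>auto simp: homeomorphism_def\<close>)
  then have 1: "bij_betw shift (A \<union> V) V"
    by (subst bij_betw_cong[where g = r]) (auto simp: shift_simps)
  have 2: "bij_betw shift front A"
  proof (rule bij_betw_byWitness[where f' = "\<lambda>a. q (a, 1 / 2)"])
    show "\<forall>x\<in>front. q (shift x, 1 / 2) = x"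
    proof
      fix x assume x: "x \<in> front"
      then have "p x = (fst (p x), 1 / 2)" "x \<in> W" by (simp_all add: front_def prod_eq_iff)
      then show "q (shift x, 1 / 2) = x" using q_p shift_simps(2)[OF x] by metis
    qed
    have *: "q (a, 1 / 2) \<in> front" if "a \<in> A" for a
      using that q_in reciprocals_half by (auto simp: front_def)
    then show "(\<lambda>a. q (a, 1 / 2)) ` A \<subseteq> front" by blast
    show "\<forall>a\<in>A. shift (q (a, 1 / 2)) = a"
      using * reciprocals_half by (auto simp: shift_simps)
    show "shift ` front \<subseteq> A"
      using p_in(1) by (auto simp: shift_simps) (auto simp: front_def)
  qed
  have 3: "bij_betw shift (W - front) W"
  proof -
    let ?J = "reciprocals"
    let ?\<tau> = "\<lambda>t::real. t / (1 - t)"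
    have "bij_betw p (W - front) (A \<times> (?J - {1 / 2}))"
    proof (rule bij_betw_byWitness[where f' = q])
      show "p ` (W - front) \<subseteq> A \<times> (?J - {1 / 2})"
      proof (rule image_subsetI)
        fix x assume "x \<in> W - front"
        then show "p x \<in> A \<times> (?J - {1 / 2})"
          using p_in[of x] by (simp add: front_def mem_Times_iff)
      qed
      show "q ` (A \<times> (?J - {1 / 2})) \<subseteq> W - front"
        using q_in by (auto simp: front_def)
    qed auto
    moreover have "bij_betw (map_prod id ?\<tau>) (A \<times> (?J - {1 / 2})) (A \<times> ?J)"
      by (intro bij_betw_map_prod reciprocals_shift) simp
    moreover have "bij_betw q (A \<times> ?J) W"
      by (rule bij_betw_byWitness[where f' = p]) (use pq in \<open>auto simp: homeomorphism_def\<close>)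
    ultimately have "bij_betw (q \<circ> (map_prod id ?\<tau> \<circ> p)) (W - front) W"
      by (rule bij_betw_trans[OF bij_betw_trans])
    then show ?thesis
      by (subst bij_betw_cong[where g = "q \<circ> (map_prod id ?\<tau> \<circ> p)"])
        (auto simp: shift_simps map_prod_def case_prod_unfold)
  qed
  have 4: "bij_betw shift (K - (A \<union> V \<union> W)) (K - (A \<union> V \<union> W))"
    by (subst bij_betw_cong[where g = id]) (auto simp: shift_simps)
  have sub: "front \<subseteq> W" by (auto simp: front_def)
  have "bij_betw shift ((((A \<union> V) \<union> front) \<union> (W - front)) \<union> (K - (A \<union> V \<union> W)))
      (((V \<union> A) \<union> W) \<union> (K - (A \<union> V \<union> W)))"
  proof (rule bij_betw_combine[OF bij_betw_combine[OF bij_betw_combine[OF 1 2] 3] 4])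
    show "V \<inter> A = {}" "(V \<union> A) \<inter> W = {}" using disjoint by auto
    show "(V \<union> A \<union> W) \<inter> (K - (A \<union> V \<union> W)) = {}" by auto
  qed
  moreover have "(((A \<union> V) \<union> front) \<union> (W - front)) \<union> (K - (A \<union> V \<union> W)) = K"
    "((V \<union> A) \<union> W) \<union> (K - (A \<union> V \<union> W)) = K"
    using subsets sub by auto
  ultimately show ?thesis by simp
qed

lemma shift_closed: "shift \<in> carrier G"
proof (rule homeo_germ_stabilizerI[OF K])
  show "bij_betw shift K K" by (rule bij_shift)
  show "continuous_on K shift"
  proof (rule continuous_on_openin_pieces)
    fix x assume x: "x \<in> K"
    have fp: "continuous_on W (\<lambda>x. fst (p x))" "continuous_on W (\<lambda>x. snd (p x))"
      using cont_p by (auto intro: continuous_intros)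
    have "continuous_on (A \<union> V) r" using r by (simp add: homeomorphism_def)
    then have "continuous_on (A \<union> V) shift"
      by (rule continuous_on_eq) (simp add: shift_simps)
    moreover have "continuous_on front (\<lambda>x. fst (p x))"
      using fp(1) by (rule continuous_on_subset) (auto simp: front_def)
    then have "continuous_on front shift"
      by (rule continuous_on_eq) (simp add: shift_simps)
    moreover have "continuous_on (W - front) (\<lambda>x. q (fst (p x), snd (p x) / (1 - snd (p x))))"
    proof (rule continuous_on_compose2[OF cont_q])
      have "t < 1" if "t \<in> reciprocals" for t using that by (auto simp: reciprocals_def)
      then have "1 - snd (p x) \<noteq> 0" if "x \<in> W" for x using p_in(2)[OF that] by force
      then show "continuous_on (W - front) (\<lambda>x. (fst (p x), snd (p x) / (1 - snd (p x))))"
        using fp by (intro continuous_intros continuous_on_subset[OF fp(1)] continuous_on_subset[OF fp(2)]) auto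
      show "(\<lambda>x. (fst (p x), snd (p x) / (1 - snd (p x)))) ` (W - front) \<subseteq> A \<times> reciprocals"
        using p_in lower_index_in by (auto simp: front_def)
    qed
    then have "continuous_on (W - front) shift"
      by (rule continuous_on_eq) (simp add: shift_simps)
    moreover have "continuous_on (K - (A \<union> V \<union> W)) shift"
      using continuous_on_id by (rule continuous_on_eq) (simp add: shift_simps)
    moreover have "openin (top_of_set K) (A \<union> V)" "openin (top_of_set K) front"
      "openin (top_of_set K) (W - front)" "openin (top_of_set K) (K - (A \<union> V \<union> W))"
      using clopen clopen_front by (auto intro!: openin_diff)
    ultimately show "\<exists>B. openin (top_of_set K) B \<and> x \<in> B \<and> continuous_on B shift"
      using x by blast
  qed
  show "openin (top_of_set K) (K - (A \<union> V \<union> W))"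
    using clopen by (intro openin_diff) auto
  show "z \<in> K - (A \<union> V \<union> W)" using z by simp
  show "shift x = x" if "x \<in> K - (A \<union> V \<union> W)" for x using that by (rule shift_simps(4))
qed (simp add: shift_def)

text \<open>On \<open>W\<close> the two maps commute, since they act on different coordinates and \<open>infinite_copy h\<close> acts on
  \<open>A\<close> as on every copy.  On \<open>A\<close> they fail to commute precisely by \<open>h\<close>, because \<open>shift\<close> leads into \<open>V\<close>,
  where \<open>infinite_copy h\<close> is the identity.\<close>

lemma shift_infinite_copy:
  assumes h: "h \<in> H" and x: "x \<in> K"
  shows "infinite_copy h (shift (h x)) = shift (infinite_copy h x)"
proof -
  have unmoved: "h y = y" if "y \<in> K" "y \<notin> A" for y
    using h that by (simp add: supported_on_def)
  have copyW: "infinite_copy h (q (a, t)) = q (h a, t)" if "a \<in> A" "t \<in> reciprocals" for a t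
    using q_in[OF that] that subsets disjoint by (auto simp: infinite_copy_def)
  have copyA: "infinite_copy h y = h y" if "y \<in> A" for y
    using that subsets by (auto simp: infinite_copy_def)
  have copy_other: "infinite_copy h y = y" if "y \<in> K" "y \<notin> A" "y \<notin> W" for y
    using that by (simp add: infinite_copy_def)
  have copyV: "infinite_copy h y = y" if "y \<in> V" for y
    using that copy_other subsets(3) disjoint by blast
  have shiftq: "shift (q (a, t)) = (if t = 1 / 2 then a else q (a, t / (1 - t)))"
    if "a \<in> A" "t \<in> reciprocals" for a t
    using q_in[OF that] that shift_simps(2,3)[of "q (a, t)"] by (auto simp: front_def)
  consider "x \<in> A" | "x \<in> W" | "x \<in> V" | "x \<notin> A" "x \<notin> V" "x \<notin> W" by blast
  then show ?thesis
  proof cases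
    case 1
    then have "h x \<in> A" using H_maps[OF h] by blast
    then have "shift (h x) \<in> V" using shift_simps(1) r_in by auto
    then show ?thesis using copyA[OF 1] copyV by simp
  next
    case 2
    define a t where "a = fst (p x)" and "t = snd (p x)"
    have x_eq: "a \<in> A" "t \<in> reciprocals" "x = q (a, t)"
      using p_in[OF 2] 2 by (auto simp: a_def t_def)
    have "h x = x" using unmoved 2 x disjoint by blast
    then show ?thesis
      using x_eq H_maps[OF h x_eq(1)] copyW[OF x_eq(1)] shiftq copyA[OF x_eq(1)] lower_index_in by simp
  next
    case 3
    then have "h x = x" using unmoved x disjoint by blast
    moreover have "shift x \<in> V" using 3 shift_simps(1) r_in by auto
    ultimately show ?thesis using copyV 3 by simp
  next
    case 4
    then show ?thesis using unmoved[OF x] copy_other[OF x] shift_simps(4)[of x] x by simp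
  qed
qed

lemma shift_notin_A: "x \<in> K \<Longrightarrow> x \<notin> W \<Longrightarrow> shift x \<notin> A"
  using shift_simps(1,4)[of x] r_in[of x] disjoint by (cases "x \<in> A \<union> V") auto

lemma copy_shift_eq:
  assumes h: "h \<in> H"
  shows "infinite_copy h \<otimes>\<^bsub>G\<^esub> shift \<otimes>\<^bsub>G\<^esub> h = shift \<otimes>\<^bsub>G\<^esub> infinite_copy h"
proof -
  interpret G: group G by (rule group_G)
  have hG: "h \<in> carrier G" using h by (simp add: supported_on_def)
  note closed = infinite_copy_closed[OF h] shift_closed
  have hK: "h x \<in> K" if "x \<in> K" for x
    using homeo_germ_stabilizer_memD(1)[OF hG] that by (auto simp: bij_betw_def)
  have "compose K (compose K (infinite_copy h) shift) h = compose K shift (infinite_copy h)"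
    using shift_infinite_copy[OF h] hK by (auto simp: compose_def)
  then show ?thesis
    using closed hG G.m_closed[OF closed]
    by (simp add: homeo_germ_stabilizer_mult)
qed

lemma commutator_identity:
  assumes h: "h \<in> H"
  shows "h = inv\<^bsub>G\<^esub> shift \<otimes>\<^bsub>G\<^esub> inv\<^bsub>G\<^esub> (infinite_copy h) \<otimes>\<^bsub>G\<^esub> shift \<otimes>\<^bsub>G\<^esub> infinite_copy h"
proof -
  interpret G: group G by (rule group_G)
  have hG: "h \<in> carrier G" using h by (simp add: supported_on_def)
  note closed = infinite_copy_closed[OF h] shift_closed hG
  have "inv\<^bsub>G\<^esub> shift \<otimes>\<^bsub>G\<^esub> inv\<^bsub>G\<^esub> (infinite_copy h) \<otimes>\<^bsub>G\<^esub> shift \<otimes>\<^bsub>G\<^esub> infinite_copy h =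
      inv\<^bsub>G\<^esub> shift \<otimes>\<^bsub>G\<^esub> inv\<^bsub>G\<^esub> (infinite_copy h) \<otimes>\<^bsub>G\<^esub> (shift \<otimes>\<^bsub>G\<^esub> infinite_copy h)"
    using closed by (simp add: G.m_assoc)
  also have "\<dots> = inv\<^bsub>G\<^esub> (infinite_copy h \<otimes>\<^bsub>G\<^esub> shift) \<otimes>\<^bsub>G\<^esub> (infinite_copy h \<otimes>\<^bsub>G\<^esub> shift \<otimes>\<^bsub>G\<^esub> h)"
    using closed by (simp add: copy_shift_eq[OF h] G.inv_mult_group)
  also have "\<dots> = h"
    using closed by (simp add: G.inv_solve_left')
  finally show ?thesis by simp
qed

text \<open>The conjugate of \<open>t\<close> by the inverse of \<open>shift\<close> is supported in the preimage of \<open>A\<close>, which lies in \<open>W\<close> and so misses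
  the support of \<open>s\<close>.\<close>

lemma conjugate_commutes:
  assumes s: "s \<in> H" and t: "t \<in> H"
  shows "s \<otimes>\<^bsub>G\<^esub> (inv\<^bsub>G\<^esub> shift \<otimes>\<^bsub>G\<^esub> t \<otimes>\<^bsub>G\<^esub> inv\<^bsub>G\<^esub> (inv\<^bsub>G\<^esub> shift)) =
    (inv\<^bsub>G\<^esub> shift \<otimes>\<^bsub>G\<^esub> t \<otimes>\<^bsub>G\<^esub> inv\<^bsub>G\<^esub> (inv\<^bsub>G\<^esub> shift)) \<otimes>\<^bsub>G\<^esub> s"
proof -
  interpret G: group G by (rule group_G)
  have tG: "t \<in> carrier G" using t by (simp add: supported_on_def)
  define u where "u = inv\<^bsub>G\<^esub> shift \<otimes>\<^bsub>G\<^esub> t \<otimes>\<^bsub>G\<^esub> shift"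
  have uG: "u \<in> carrier G" using tG shift_closed by (simp add: u_def)
  have "shift \<otimes>\<^bsub>G\<^esub> u = t \<otimes>\<^bsub>G\<^esub> shift"
    using tG shift_closed by (simp add: u_def G.m_assoc[symmetric])
  then have eq: "compose K shift u = compose K t shift"
    using tG uG shift_closed by (simp add: homeo_germ_stabilizer_mult)
  have "u x = x" if x: "x \<in> K - W" for x
  proof -
    have "shift x \<in> K - A" using x shift_notin_A bij_shift by (auto simp: bij_betw_def)
    then have "t (shift x) = shift x" using t by (simp add: supported_on_def)
    then have "shift (u x) = shift x" using fun_cong[OF eq, of x] x by (simp add: compose_def)
    moreover have "u x \<in> K" using homeo_germ_stabilizer_memD(1)[OF uG] x by (auto simp: bij_betw_def)
    ultimately show "u x = x" using bij_shift x by (auto simp: bij_betw_def inj_on_def)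
  qed
  then have "u \<in> supported_on (carrier G) K W" using uG by (simp add: supported_on_def)
  then have "s \<otimes>\<^bsub>G\<^esub> u = u \<otimes>\<^bsub>G\<^esub> s"
    using s subsets disjoint by (intro supported_on_disjoint_commute)
  then show ?thesis using shift_closed by (simp add: u_def)
qed

end

text \<open>Finitely many elements fix a common clopen neighbourhood \<open>B\<close> of \<open>z\<close>, and \<open>A\<close> is its complement.
  Since \<open>z\<close> is not isolated, \<open>B\<close> contains a nonempty clopen set \<open>D\<close> that misses \<open>z\<close>, and \<open>D\<close> splits into \<open>W\<close> and
  \<open>V\<close>.\<close>

lemma ex_cantor_mitosis:
  fixes K :: "'a::metric_space set"
  assumes K: "cantor_set K" and z: "z \<in> K"
    and S: "finite S" "S \<subseteq> carrier (homeo_germ_stabilizer K z)"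
  shows "\<exists>A W V p q r r'. cantor_mitosis K z A W V p q r r' \<and>
    S \<subseteq> supported_on (carrier (homeo_germ_stabilizer K z)) K A"
proof -
  have cpt: "compact K" and td: "totally_disconnected K" using K by (auto simp: cantor_set_def)
  have "\<forall>g\<in>S. \<exists>U. openin (top_of_set K) U \<and> z \<in> U \<and> (\<forall>x\<in>U. g x = x)"
    using S(2) by (auto simp: homeo_germ_stabilizer_carrier)
  then obtain U where U: "\<And>g. g \<in> S \<Longrightarrow> openin (top_of_set K) (U g)" "\<And>g. g \<in> S \<Longrightarrow> z \<in> U g"
    "\<And>g x. g \<in> S \<Longrightarrow> x \<in> U g \<Longrightarrow> g x = x" by metis
  \<comment> \<open>Removing a point \<open>y\<close> from the neighbourhood makes \<open>A\<close> nonempty even if all given elements are trivial.\<close>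
  obtain y where y: "y \<in> K" "y \<noteq> z"
    using K z unfolding cantor_set_def by (meson UNIV_I islimptE open_UNIV)
  define Q where "Q = \<Inter>(insert (K - {y}) (U ` S))"
  have "openin (top_of_set K) (K - {y})" using y(1) by (intro openin_diff) auto
  then have "openin (top_of_set K) Q"
    unfolding Q_def using S(1) U(1) by (intro openin_Inter) auto
  moreover have "z \<in> Q" using z y U(2) by (auto simp: Q_def)
  ultimately obtain B where B: "clopen_in K B" "z \<in> B" "B \<subseteq> Q"
    by (rule clopen_neighbourhood[OF cpt td])
  have "z islimpt B" using cantor_set_clopen[OF K B(1)] B(2) by (simp add: cantor_set_def)
  then obtain y' where y': "y' \<in> B" "y' \<noteq> z" by (meson UNIV_I islimptE open_UNIV)
  obtain C where C: "clopen_in K C" "z \<in> C" "y' \<notin> C"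
    using clopen_separation[OF cpt td z] y' clopen_in_subset[OF B(1)] by blast
  define A where "A = K - B"
  define D where "D = B - C"
  have AK: "clopen_in K A" unfolding A_def by (intro clopen_in_Diff clopen_in_self B(1))
  have DK: "clopen_in K D" unfolding D_def by (intro clopen_in_Diff B(1) C(1))
  have "y \<in> A" using y B(3) by (auto simp: A_def Q_def)
  have "y' \<in> D" using y' C by (simp add: D_def)
  then have "D \<noteq> {}" by blast
  then obtain W where W: "clopen_in D W" "W \<noteq> {}" "D - W \<noteq> {}"
    using cantor_set_split[OF cantor_set_clopen[OF K DK]] by blast
  define V where "V = D - W"
  have WK: "clopen_in K W" using clopen_in_trans[OF W(1) DK] .
  have VK: "clopen_in K V" unfolding V_def by (intro clopen_in_Diff DK WK)
  have WD: "W \<subseteq> D" using clopen_in_subset[OF W(1)] .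
  have "cantor_set (A \<times> reciprocals)"
    by (intro cantor_set_Times_countable cantor_set_clopen[OF K AK] compact_reciprocals
        countable_reciprocals)
  then have "W homeomorphic (A \<times> reciprocals)"
    using cantor_sets_homeomorphic[OF cantor_set_clopen[OF K WK] W(2)] \<open>y \<in> A\<close> reciprocals_half
    by blast
  then obtain p q where pq: "homeomorphism W (A \<times> reciprocals) p q" unfolding homeomorphic_def by blast
  have "A \<union> V homeomorphic V"
    using cantor_sets_homeomorphic[OF cantor_set_clopen[OF K clopen_in_Un[OF AK VK]] _
        cantor_set_clopen[OF K VK]] \<open>y \<in> A\<close> W(3) by (auto simp: V_def)
  then obtain r r' where r: "homeomorphism (A \<union> V) V r r'" unfolding homeomorphic_def by blast
  have "cantor_mitosis K z A W V p q r r'"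
    by unfold_locales
      (use cpt z AK WK VK pq r B(2) C(2) WD in \<open>auto simp: A_def D_def V_def\<close>)
  moreover have "g \<in> supported_on (carrier (homeo_germ_stabilizer K z)) K A" if g: "g \<in> S" for g
  proof -
    have "g x = x" if "x \<in> K - A" for x
      using U(3)[OF g] B(3) that g by (auto simp: A_def Q_def)
    then show ?thesis using S(2) g by (auto simp: supported_on_def)
  qed
  ultimately show ?thesis by blast
qed

lemma commuting_conjugates_homeo_germ_stabilizer:
  fixes K :: "'a::metric_space set"
  assumes K: "cantor_set K" and z: "z \<in> K"
  shows "commuting_conjugates (homeo_germ_stabilizer K z)"
  unfolding commuting_conjugates_def
proof (intro allI impI, elim conjE)
  let ?G = "homeo_germ_stabilizer K z"
  interpret G: group ?G using z by (rule group_homeo_germ_stabilizer)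
  fix S assume fin: "finite S" "S \<subseteq> carrier ?G"
  obtain A W V p q r r' where m: "cantor_mitosis K z A W V p q r r'"
    and S: "S \<subseteq> supported_on (carrier ?G) K A"
    using ex_cantor_mitosis[OF K z fin] by (elim exE conjE)
  interpret cantor_mitosis K z A W V p q r r' by (rule m)
  show "\<exists>g\<in>carrier ?G. \<forall>s\<in>S. \<forall>t\<in>S. s \<otimes>\<^bsub>?G\<^esub> (g \<otimes>\<^bsub>?G\<^esub> t \<otimes>\<^bsub>?G\<^esub> inv\<^bsub>?G\<^esub> g) =
      g \<otimes>\<^bsub>?G\<^esub> t \<otimes>\<^bsub>?G\<^esub> inv\<^bsub>?G\<^esub> g \<otimes>\<^bsub>?G\<^esub> s"
  proof (intro bexI ballI)
    fix s t assume "s \<in> S" "t \<in> S"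
    then have "s \<in> H" "t \<in> H" using S by auto
    then show "s \<otimes>\<^bsub>?G\<^esub> (inv\<^bsub>?G\<^esub> shift \<otimes>\<^bsub>?G\<^esub> t \<otimes>\<^bsub>?G\<^esub> inv\<^bsub>?G\<^esub> (inv\<^bsub>?G\<^esub> shift)) =
        inv\<^bsub>?G\<^esub> shift \<otimes>\<^bsub>?G\<^esub> t \<otimes>\<^bsub>?G\<^esub> inv\<^bsub>?G\<^esub> (inv\<^bsub>?G\<^esub> shift) \<otimes>\<^bsub>?G\<^esub> s"
      by (rule conjugate_commutes)
  qed (rule G.inv_closed[OF shift_closed])
qed

lemma binate_homeo_germ_stabilizer:
  fixes K :: "'a::metric_space set"
  assumes K: "cantor_set K" and z: "z \<in> K"
  shows "binate (homeo_germ_stabilizer K z)"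
  unfolding binate_def
proof (intro conjI allI impI)
  let ?G = "homeo_germ_stabilizer K z"
  show "group ?G" using z by (rule group_homeo_germ_stabilizer)
  then interpret G: group ?G .
  fix L assume "subgroup L ?G \<and> (\<exists>S. finite S \<and> S \<subseteq> carrier ?G \<and> L = generate ?G S)"
  then obtain S where S: "finite S" "S \<subseteq> carrier ?G" "L = generate ?G S" by blast
  obtain A W V p q r r' where m: "cantor_mitosis K z A W V p q r r'"
    and SH: "S \<subseteq> supported_on (carrier ?G) K A"
    using ex_cantor_mitosis[OF K z S(1,2)] by (elim exE conjE)
  interpret cantor_mitosis K z A W V p q r r' by (rule m)
  have L: "L \<subseteq> H"
    unfolding S(3) using SH by (rule G.generate_subgroup_incl) (rule subgroup_supported_on[OF \<open>z \<in> K\<close>])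
  show "\<exists>\<phi>\<in>hom (?G\<lparr>carrier := L\<rparr>) ?G. \<exists>\<gamma>\<in>carrier ?G. \<forall>h\<in>L.
      h = inv\<^bsub>?G\<^esub> \<gamma> \<otimes>\<^bsub>?G\<^esub> inv\<^bsub>?G\<^esub> (\<phi> h) \<otimes>\<^bsub>?G\<^esub> \<gamma> \<otimes>\<^bsub>?G\<^esub> \<phi> h"
  proof (intro bexI ballI)
    show "h = inv\<^bsub>?G\<^esub> shift \<otimes>\<^bsub>?G\<^esub> inv\<^bsub>?G\<^esub> (infinite_copy h) \<otimes>\<^bsub>?G\<^esub> shift \<otimes>\<^bsub>?G\<^esub> infinite_copy h"
      if "h \<in> L" for h
      using L that by (intro commutator_identity) blast
    show "infinite_copy \<in> hom (?G\<lparr>carrier := L\<rparr>) ?G"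
    proof (rule homI)
      fix h k assume "h \<in> carrier (?G\<lparr>carrier := L\<rparr>)" "k \<in> carrier (?G\<lparr>carrier := L\<rparr>)"
      then have "h \<in> H" "k \<in> H" using L by auto
      then show "infinite_copy (h \<otimes>\<^bsub>?G\<lparr>carrier := L\<rparr>\<^esub> k) = infinite_copy h \<otimes>\<^bsub>?G\<^esub> infinite_copy k"
        using hom_mult[OF infinite_copy_hom, of h k] by simp
    next
      fix h assume "h \<in> carrier (?G\<lparr>carrier := L\<rparr>)"
      then have "h \<in> H" using L by auto
      then show "infinite_copy h \<in> carrier ?G" by (rule infinite_copy_closed)
    qed
  qed (rule shift_closed)
qed

theorem lemma1p14:
  fixes K :: "'a::metric_space set" and z :: 'a
  assumes "cantor_set K" and "z \<in> K"
  shows "binate (homeo_germ_stabilizer K z) \<and>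
    boundedly_acyclic (homeo_germ_stabilizer K z)"
  using binate_homeo_germ_stabilizer[OF assms]
    group.commuting_conjugates_imp_boundedly_acyclic[OF group_homeo_germ_stabilizer[OF assms(2)]
      commuting_conjugates_homeo_germ_stabilizer[OF assms]]
  by blast

end
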